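(* Fix $0<\varepsilon<\varepsilon_1<1$. There is a sequence $(\mathcal{A}_N)_{N\ge1}$ of algorithms, $\mathcal{A}_N$ an $N$-sample algorithm (depending only on $N,\varepsilon,\varepsilon_1$), such that for every fixed reservoir distribution $\mu$ with $\mu^*>\varepsilon$, letting $a_{i^*}$ be the output of $\mathcal{A}_N$ run on $\mu$, \[ \limsup_{N\to\infty}\frac{\big(-\log\mathbb{P}[p_{i^*}<\mu^*-\varepsilon_1]\big)\cdot\log^2N}{N}\ \ge\ c_{\mu^*,\mu^*-\varepsilon}. \]
   Context: Infinite-armed Bernoulli bandit: a reservoir distribution $\mu$ is any Borel probability measure on $[0,1]$; $\mu^*$ denotes its essential supremum (the maximum of its support). There are countably many arms $a_1,a_2,\dots$ whose means $p_1,p_2,\dots$ are drawn i.i.d. from $\mu$ (unknown to the algorithm). Each time arm $a_i$ is sampled it returns a reward in $\{0,1\}$ distributed as Bernoulli$(p_i)$, independently of all other rewards given the means. An algorithm, at each step, chooses (based on previously observed rewards and possibly internal randomness) an arm to sample, and at the end outputs an arm index $i^*$. An $N$-sample algorithm takes exactly $N$ samples almost surely and then outputs $i^*$. For $a,b\in[0,1]$, $c_{a,b}=\frac{(\arccos(1-2a)-\arccos(1-2b))^2}{2}$. *)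

theory Defs
  imports "HOL-Probability.Probability"
begin

text \<open>A history is the list of (arm index, observed reward) pairs, in sampling order.\<close>
type_synonym history = "(nat \<times> bool) list"

text \<open>A (possibly randomized) bandit algorithm: a rule choosing the distribution of the
next arm to sample given the history so far, and a rule choosing the distribution of the
output arm index given the full history.\<close>
type_synonym bandit_alg = "(history \<Rightarrow> nat pmf) \<times> (history \<Rightarrow> nat pmf)"

fun run_hist :: "bandit_alg \<Rightarrow> (nat \<Rightarrow> real) \<Rightarrow> nat \<Rightarrow> history pmf" where
  "run_hist A p 0 = return_pmf []"
| "run_hist A p (Suc n) =
     bind_pmf (run_hist A p n) (\<lambda>h.
     bind_pmf (fst A h) (\<lambda>i.
     bind_pmf (bernoulli_pmf (p i)) (\<lambda>r. return_pmf (h @ [(i, r)]))))"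

definition output_dist :: "bandit_alg \<Rightarrow> (nat \<Rightarrow> real) \<Rightarrow> nat \<Rightarrow> nat pmf" where
  "output_dist A p N = bind_pmf (run_hist A p N) (snd A)"

definition reservoir :: "real measure \<Rightarrow> bool" where
  "reservoir \<mu> \<longleftrightarrow> prob_space \<mu> \<and> sets \<mu> = sets borel \<and> emeasure \<mu> {0..1} = 1"

definition res_sup :: "real measure \<Rightarrow> real" where
  "res_sup \<mu> = real_of_ereal (esssup \<mu> (\<lambda>x. ereal x))"

definition means_measure :: "real measure \<Rightarrow> (nat \<Rightarrow> real) measure" where
  "means_measure \<mu> = PiM UNIV (\<lambda>_. \<mu>)"

definition fail_prob :: "bandit_alg \<Rightarrow> real measure \<Rightarrow> nat \<Rightarrow> real \<Rightarrow> real" where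
  "fail_prob A \<mu> N t =
     enn2real (\<integral>\<^sup>+ p. ennreal (measure_pmf.prob (output_dist A p N) {i. p i < t})
                 \<partial>means_measure \<mu>)"

definition rate_term :: "real \<Rightarrow> nat \<Rightarrow> ereal" where
  "rate_term P N = (if P = 0 then \<infinity> else ereal ((- ln P) * (ln (real N))^2 / real N))"

definition c_const :: "real \<Rightarrow> real \<Rightarrow> real" where
  "c_const a b = (arccos (1 - 2*a) - arccos (1 - 2*b))^2 / 2"

end

theory Submission
  imports Defs "HOL-Real_Asymp.Real_Asymp"
begin

text \<open>
  Arms are tried one after the other. An arm is dropped as soon as the number of its successes
  falls below a time-dependent threshold, and is kept forever once it has survived
  \<open>T = N / ln N\<close> samples. In the variance-stabilising coordinate \<open>p = (1 - cos \<phi>) / 2\<close> the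
  threshold decreases like \<open>b - D ln t\<close> with \<open>D = (b - a) / ln N\<close>, so that it moves through the
  whole angular interval from \<open>b\<close> to \<open>a\<close> within \<open>N\<close> steps.

  Writing \<open>\<tau>\<close> for the time at which an arm is dropped, a Chernoff bound over many arms reduces the
  claim to \<open>E[exp (\<theta> \<tau>); dropped] \<le> 1\<close> for \<open>\<theta>\<close> slightly below \<open>D\<^sup>2 / 2\<close>. Near-optimal arms are
  never dropped with probability close to one, which leaves room for the contribution of large
  \<open>\<tau>\<close>. The latter is small because, whatever the mean of the arm, being above the threshold at all
  earlier times and below it at time \<open>t\<close> has probability at most about \<open>exp (- t D\<^sup>2 / 2)\<close>. The cheapest
  way to do so is to follow the threshold up to time \<open>t\<close>, at the cost
  \<open>(D\<^sup>2 / 2) \<integral>\<^sub>0\<^sup>t (ln (t / u) - 1)\<^sup>2 du = t D\<^sup>2 / 2\<close>.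

  The angles depend on the unknown essential supremum. As only an upper limit is claimed, the
  \<open>N\<close>-th algorithm may use the rational triple coded by \<open>N\<close>, in a coding where each triple
  occurs infinitely often.
\<close>

subsection \<open>Racing one arm after the other\<close>

definition words :: "nat \<Rightarrow> bool list set" where
  "words t = {w. length w = t}"

definition bprob :: "real \<Rightarrow> bool list \<Rightarrow> real" where
  "bprob q w = (\<Prod>j<length w. if w ! j then q else 1 - q)"

lemma finite_words [simp]: "finite (words t)"
  using finite_lists_length_eq[of "UNIV :: bool set" t] by (simp add: words_def)

lemma words_0: "words 0 = {[]}"
  by (auto simp: words_def)

lemma sum_words_Suc:
  "(\<Sum>w\<in>words (Suc t). f w) = (\<Sum>w\<in>words t. f (w @ [True]) + f (w @ [False]))"
proof -
  have "words (Suc t) = (\<lambda>(w, r). w @ [r]) ` (words t \<times> UNIV)"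
    by (force simp: words_def image_iff length_Suc_conv_rev)
  moreover have "inj_on (\<lambda>(w, r). w @ [r]) (words t \<times> UNIV)"
    by (auto simp: inj_on_def)
  ultimately have "(\<Sum>w\<in>words (Suc t). f w) = (\<Sum>(w, r)\<in>words t \<times> UNIV. f (w @ [r]))"
    by (simp add: sum.reindex case_prod_unfold)
  also have "\<dots> = (\<Sum>w\<in>words t. \<Sum>r\<in>UNIV. f (w @ [r]))"
    by (simp add: sum.cartesian_product)
  finally show ?thesis by (simp add: UNIV_bool add.commute)
qed

lemma bprob_Nil [simp]: "bprob q [] = 1"
  by (simp add: bprob_def)

lemma bprob_snoc [simp]: "bprob q (w @ [r]) = bprob q w * (if r then q else 1 - q)"
  by (simp add: bprob_def nth_append lessThan_Suc)

lemma bprob_nonneg: "0 \<le> q \<Longrightarrow> q \<le> 1 \<Longrightarrow> 0 \<le> bprob q w"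
  by (auto simp: bprob_def intro!: prod_nonneg)

lemma sum_words_le: "(\<Sum>w\<in>(\<Union>t\<le>n. words t). f w) = (\<Sum>t\<le>n. \<Sum>w\<in>words t. f w)"
proof (rule sum.UNION_disjoint)
  show "\<forall>i\<in>{..n}. \<forall>j\<in>{..n}. i \<noteq> j \<longrightarrow> words i \<inter> words j = {}"
    by (auto simp: words_def)
qed simp_all

text \<open>Independence of the rewards in algebraic form: expanding the product of sums gives one
  term per word.\<close>

lemma sum_words_prod:
  fixes f :: "nat \<Rightarrow> bool \<Rightarrow> real"
  shows "(\<Sum>w\<in>words t. \<Prod>j<t. f j (w ! j)) = (\<Prod>j<t. f j True + f j False)"
proof (induction t)
  case 0
  then show ?case by (simp add: words_0)
next
  case (Suc t)
  have *: "(\<Prod>j<t. f j ((w @ [r]) ! j)) = (\<Prod>j<t. f j (w ! j))" "(w @ [r]) ! t = r"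
    if "w \<in> words t" for w r
    using that by (auto simp: words_def nth_append intro!: prod.cong)
  show ?case
    by (simp add: sum_words_Suc * distrib_left sum.distrib flip: Suc.IH sum_distrib_right)
qed

text \<open>The weights of the two possible next rewards add up to one, so rewards after the first
  \<open>s\<close> integrate out. This is the consistency of the Bernoulli product laws.\<close>

lemma sum_bprob_take:
  assumes "s \<le> t"
  shows "(\<Sum>w\<in>words t. bprob q w * f (take s w)) = (\<Sum>w\<in>words s. bprob q w * f w)"
  using assms
proof (induction t rule: dec_induct)
  case base
  show ?case by (intro sum.cong) (auto simp: words_def)
next
  case (step t)
  have *: "take s (w @ [r]) = take s w" if "w \<in> words t" for w r
    using that step by (simp add: words_def)
  have "(\<Sum>w\<in>words (Suc t). bprob q w * f (take s w)) = (\<Sum>w\<in>words t. bprob q w * f (take s w))"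
    by (simp add: sum_words_Suc * algebra_simps del: take_append)
  then show ?case by (simp add: step.IH)
qed

lemma sum_bprob: "(\<Sum>w\<in>words t. bprob q w) = 1"
  using sum_bprob_take[of 0 t q "\<lambda>_. 1"] by (simp add: words_0)

text \<open>A state consists of the current arm and of the rewards it has returned so far; \<open>D\<close> tells which
  reward words cause an arm to be dropped.\<close>
definition race_step :: "(bool list \<Rightarrow> bool) \<Rightarrow> nat \<times> bool list \<Rightarrow> bool \<Rightarrow> nat \<times> bool list" where
  "race_step D s r = (if D (snd s @ [r]) then (Suc (fst s), []) else (fst s, snd s @ [r]))"

text \<open>Only the rewards in the history are read: in runs of \<open>race_alg\<close> they
  determine the arm indices.\<close>

definition race_state :: "(bool list \<Rightarrow> bool) \<Rightarrow> history \<Rightarrow> nat \<times> bool list" where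
  "race_state D h = foldl (race_step D) (0, []) (map snd h)"

definition race_alg :: "(bool list \<Rightarrow> bool) \<Rightarrow> bandit_alg" where
  "race_alg D = (\<lambda>h. return_pmf (fst (race_state D h)), \<lambda>h. return_pmf (fst (race_state D h)))"

fun race_chain :: "(bool list \<Rightarrow> bool) \<Rightarrow> (nat \<Rightarrow> real) \<Rightarrow> nat \<Rightarrow> (nat \<times> bool list) pmf" where
  "race_chain D p 0 = return_pmf (0, [])"
| "race_chain D p (Suc n) =
     bind_pmf (race_chain D p n) (\<lambda>s. map_pmf (race_step D s) (bernoulli_pmf (p (fst s))))"

text \<open>Both rules of \<open>race_alg\<close> see a history only through its state, and a new
  sample updates the state by \<open>race_step\<close>. The history process therefore projects onto
  a Markov chain of states.\<close>

lemma map_race_state: "map_pmf (race_state D) (run_hist (race_alg D) p n) = race_chain D p n"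
proof (induction n)
  case 0
  then show ?case by (simp add: race_state_def)
next
  case (Suc n)
  have "race_state D (h @ [(i, r)]) = race_step D (race_state D h) r" for h i r
    by (simp add: race_state_def)
  then show ?case
    by (simp add: Suc[symmetric] map_bind_pmf bind_map_pmf race_alg_def bind_return_pmf
        map_pmf_def[of "race_step D _"] comp_def)
qed

lemma output_dist_race: "output_dist (race_alg D) p N = map_pmf fst (race_chain D p N)"
  by (simp add: output_dist_def race_alg_def map_pmf_def[symmetric] map_race_state[symmetric]
      pmf.map_comp comp_def)

section \<open>Survival of an arm, and decomposition of the chain by the starting time of the
  current arm\<close>

definition alive :: "(bool list \<Rightarrow> bool) \<Rightarrow> bool list \<Rightarrow> bool" where
  "alive D w \<longleftrightarrow> (\<forall>u. 0 < u \<and> u \<le> length w \<longrightarrow> \<not> D (take u w))"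

definition first_dead :: "(bool list \<Rightarrow> bool) \<Rightarrow> bool list \<Rightarrow> bool" where
  "first_dead D w \<longleftrightarrow> w \<noteq> [] \<and> D w \<and> alive D (butlast w)"

lemma alive_Nil [simp]: "alive D []"
  by (simp add: alive_def)

lemma alive_snoc [simp]: "alive D (w @ [r]) \<longleftrightarrow> alive D w \<and> \<not> D (w @ [r])"
  by (auto simp: alive_def le_Suc_eq)

lemma first_dead_snoc [simp]: "first_dead D (w @ [r]) \<longleftrightarrow> alive D w \<and> D (w @ [r])"
  by (auto simp: first_dead_def)

text \<open>\<open>bernoulli_pmf\<close> truncates its parameter to the unit interval. Carrying the
  truncation along makes the bounds valid for every sequence of means, although the means lie in
  [0,1] only almost surely.\<close>

abbreviation bern_mean :: "real \<Rightarrow> real" where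
  "bern_mean x \<equiv> min 1 (max 0 x)"

lemma pmf_bernoulli_clamp:
  "pmf (bernoulli_pmf x) r = (if r then bern_mean x else 1 - bern_mean x)"
  by (cases r) (simp_all add: bernoulli_pmf.rep_eq)

lemma race_chain_support:
  assumes "(i, w) \<in> set_pmf (race_chain D p n)"
  shows "i \<le> n" "length w \<le> n" "w = [] \<Longrightarrow> i = 0 \<Longrightarrow> n = 0"
proof -
  have "fst s \<le> n \<and> length (snd s) \<le> n \<and> (snd s = [] \<longrightarrow> fst s = 0 \<longrightarrow> n = 0)"
    if "s \<in> set_pmf (race_chain D p n)" for s
    using that
    by (induction n arbitrary: s) (force simp: race_step_def split: if_splits)+
  from this[OF assms] show "i \<le> n" "length w \<le> n" "w = [] \<Longrightarrow> i = 0 \<Longrightarrow> n = 0" by auto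
qed

text \<open>A state with a nonempty word has a single predecessor, since dropping an arm empties the
  word.\<close>

lemma pmf_race_chain_snoc:
  "pmf (race_chain D p (Suc n)) (i, w @ [r]) =
     (if D (w @ [r]) then 0
      else pmf (race_chain D p n) (i, w) * (if r then bern_mean (p i) else 1 - bern_mean (p i)))"
proof -
  let ?b = "pmf (bernoulli_pmf (p i)) r"
  have "pmf (map_pmf (race_step D s) (bernoulli_pmf (p (fst s)))) (i, w @ [r]) =
      (if D (w @ [r]) then 0 else ?b) * indicator {(i, w)} s" for s
  proof -
    have "race_step D s -` {(i, w @ [r])} = (if s = (i, w) \<and> \<not> D (w @ [r]) then {r} else {})"
      by (cases s) (auto simp: race_step_def split: if_splits)
    then show ?thesis
      by (auto simp: pmf_map measure_pmf_single)
  qed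
  then have "pmf (race_chain D p (Suc n)) (i, w @ [r]) =
      (if D (w @ [r]) then 0 else ?b) * pmf (race_chain D p n) (i, w)"
    by (simp add: pmf_bind measure_pmf_single)
  then show ?thesis by (simp add: pmf_bernoulli_clamp)
qed

lemma pmf_race_chain_fresh_0: "pmf (race_chain D p n) (0, []) = (if n = 0 then 1 else 0)"
  using race_chain_support(3)[of 0 "[]" D p n] by (auto simp: set_pmf_iff)

text \<open>Arms are never revisited, so holding \<open>w\<close> on arm \<open>i\<close> at time
  \<open>n\<close> means having started that arm \<open>length w\<close> steps earlier and then
  having seen exactly \<open>w\<close>, with no prefix causing a drop.\<close>

lemma pmf_race_chain_eq:
  assumes "length w \<le> n"
  shows "pmf (race_chain D p n) (i, w) =
    (if alive D w then pmf (race_chain D p (n - length w)) (i, []) * bprob (bern_mean (p i)) w else 0)"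
  using assms
proof (induction w arbitrary: n rule: rev_induct)
  case (snoc r w)
  then obtain n' where "n = Suc n'" by (cases n) auto
  with snoc show ?case by (simp add: pmf_race_chain_snoc del: race_chain.simps)
qed simp

text \<open>Renewal equation: arm \<open>Suc i\<close> starts at the very step that drops arm
  \<open>i\<close>, which started at time \<open>n - t\<close> if it received \<open>Suc t\<close>
  rewards.\<close>

lemma pmf_race_chain_fresh_Suc:
  "pmf (race_chain D p (Suc n)) (Suc i, []) =
    (\<Sum>t\<le>n. pmf (race_chain D p (n - t)) (i, []) *
       (\<Sum>w\<in>{w\<in>words (Suc t). first_dead D w}. bprob (bern_mean (p i)) w))"
proof -
  let ?B = "bernoulli_pmf (p i)"
  let ?A = "{i} \<times> (\<Union>t\<le>n. words t)"
  let ?f = "\<lambda>w. \<Sum>r\<in>UNIV. if D (w @ [r]) then pmf ?B r else 0"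
  have *: "pmf (map_pmf (race_step D s) (bernoulli_pmf (p (fst s)))) (Suc i, []) =
      ?f (snd s) * indicator {s. fst s = i} s" for s
  proof -
    have "race_step D s -` {(Suc i, [])} = (if fst s = i then {r. D (snd s @ [r])} else {})"
      by (cases s) (auto simp: race_step_def split: if_splits)
    then show ?thesis
      by (auto simp: pmf_map measure_measure_pmf_finite sum.inter_filter[symmetric] intro!: sum.cong)
  qed
  have fin: "finite ?A" by simp
  have "pmf (race_chain D p (Suc n)) (Suc i, []) =
      measure_pmf.expectation (race_chain D p n) (\<lambda>s. ?f (snd s) * indicator {s. fst s = i} s)"
    unfolding race_chain.simps pmf_bind * ..
  also have "\<dots> = (\<Sum>s\<in>?A. pmf (race_chain D p n) s *\<^sub>R (?f (snd s) * indicator {s. fst s = i} s))"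
  proof (rule integral_measure_pmf[OF fin])
    fix s assume "s \<in> set_pmf (race_chain D p n)" "?f (snd s) * indicator {s. fst s = i} s \<noteq> 0"
    then show "s \<in> ?A"
      using race_chain_support(2)[of "fst s" "snd s"]
      by (cases s) (auto simp: words_def indicator_def split: if_splits)
  qed
  also have "\<dots> = (\<Sum>s\<in>?A. pmf (race_chain D p n) s * ?f (snd s))"
    by (intro sum.cong) auto
  also have "\<dots> = (\<Sum>w\<in>(\<Union>t\<le>n. words t). pmf (race_chain D p n) (i, w) * ?f w)"
    by (rule sum.reindex_bij_witness[where i = "Pair i" and j = snd]) auto
  also have "\<dots> = (\<Sum>t\<le>n. \<Sum>w\<in>words t. pmf (race_chain D p n) (i, w) * ?f w)"
    by (rule sum_words_le)
  also have "\<dots> = (\<Sum>t\<le>n. pmf (race_chain D p (n - t)) (i, []) *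
       (\<Sum>w\<in>{w\<in>words (Suc t). first_dead D w}. bprob (bern_mean (p i)) w))"
  proof (rule sum.cong[OF refl])
    fix t assume t: "t \<in> {..n}"
    have "(\<Sum>w\<in>words t. pmf (race_chain D p n) (i, w) * ?f w) =
      (\<Sum>w\<in>words t. pmf (race_chain D p (n - t)) (i, []) *
        (if alive D w then bprob (bern_mean (p i)) w * ?f w else 0))"
      using t by (intro sum.cong refl, subst pmf_race_chain_eq) (auto simp: words_def)
    also have "\<dots> = pmf (race_chain D p (n - t)) (i, []) *
       (\<Sum>w\<in>words (Suc t). if first_dead D w then bprob (bern_mean (p i)) w else 0)"
    proof -
      have "(if alive D w then bprob (bern_mean (p i)) w * ?f w else 0) =
        (if first_dead D (w @ [True]) then bprob (bern_mean (p i)) (w @ [True]) else 0) +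
        (if first_dead D (w @ [False]) then bprob (bern_mean (p i)) (w @ [False]) else 0)" for w
        by (auto simp: UNIV_bool pmf_bernoulli_clamp algebra_simps)
      then show ?thesis
        unfolding sum_words_Suc sum_distrib_left[symmetric] by (simp only:)
    qed
    finally show "(\<Sum>w\<in>words t. pmf (race_chain D p n) (i, w) * ?f w) =
       pmf (race_chain D p (n - t)) (i, []) *
       (\<Sum>w\<in>{w\<in>words (Suc t). first_dead D w}. bprob (bern_mean (p i)) w)"
      by (simp add: sum.inter_filter)
  qed
  finally show ?thesis .
qed

text \<open>The law of the dropping time of an arm of mean \<open>q\<close>. Its total mass may be
  below one; the missing mass is the probability of being kept forever.\<close>

definition dead_prob :: "(bool list \<Rightarrow> bool) \<Rightarrow> real \<Rightarrow> nat \<Rightarrow> real" where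
  "dead_prob D q t = (\<Sum>w\<in>{w\<in>words t. first_dead D w}. bprob q w)"

lemma dead_prob_nonneg: "0 \<le> q \<Longrightarrow> q \<le> 1 \<Longrightarrow> 0 \<le> dead_prob D q t"
  by (auto simp: dead_prob_def intro!: sum_nonneg bprob_nonneg)

text \<open>The probability of moving to a fresh arm at time \<open>m\<close> is a convolution over the arms, so its
  exponentially weighted sums multiply.\<close>
lemma exp_weighted_fresh_le:
  fixes g :: "nat \<Rightarrow> real" and \<theta> :: real and T :: nat
  assumes D: "\<And>w. D w \<Longrightarrow> length w \<le> T"
    and g: "\<And>i. (\<Sum>t=1..T. exp (\<theta> * t) * dead_prob D (bern_mean (p i)) t) \<le> g i"
  shows "(\<Sum>m\<le>N. exp (\<theta> * m) * pmf (race_chain D p m) (i, [])) \<le> (\<Prod>j<i. g j)"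
proof (induction i arbitrary: N)
  case 0
  show ?case by (simp add: pmf_race_chain_fresh_0 if_distrib sum.delta cong: if_cong)
next
  case (Suc i)
  let ?S = "\<lambda>i m. exp (\<theta> * real m) * pmf (race_chain D p m) (i, [])"
  let ?d = "\<lambda>t. exp (\<theta> * real t) * dead_prob D (bern_mean (p i)) t"
  have d0: "0 \<le> ?d t" for t by (simp add: dead_prob_nonneg)
  have S0: "0 \<le> sum (?S j) A" for j A by (intro sum_nonneg) auto
  have dT: "dead_prob D (bern_mean (p i)) t = 0" if "\<not> t \<le> T" for t
  proof -
    have "{w\<in>words t. first_dead D w} = {}"
      using that D by (fastforce simp: words_def first_dead_def)
    then show ?thesis unfolding dead_prob_def by (metis sum.empty)
  qed
  have step: "?S (Suc i) (Suc m) = (\<Sum>t\<le>m. ?S i (m - t) * ?d (Suc t))" for m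
  proof -
    have "exp (\<theta> * real (Suc m)) = exp (\<theta> * real (m - t)) * exp (\<theta> * real (Suc t))" if "t \<le> m" for t
      using that by (simp add: exp_add[symmetric] of_nat_diff algebra_simps)
    then show ?thesis
      unfolding pmf_race_chain_fresh_Suc sum_distrib_left dead_prob_def[symmetric]
      by (intro sum.cong) (simp_all only: atMost_iff mult.assoc mult.left_commute)
  qed
  have "(\<Sum>m\<le>N. ?S (Suc i) m) = (\<Sum>m<N. ?S (Suc i) (Suc m))"
    unfolding lessThan_Suc_atMost[symmetric] sum.lessThan_Suc_shift by simp
  also have "\<dots> = (\<Sum>m<N. \<Sum>t\<le>m. ?S i (m - t) * ?d (Suc t))"
    by (simp only: step)
  \<comment> \<open>Using \<open>m - t\<close>, the starting time of arm \<open>i\<close>, as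
    summation variable turns the convolution into a product of truncated sums.\<close>
  also have "\<dots> = (\<Sum>t<N. \<Sum>m<N-t. ?S i m * ?d (Suc t))"
    unfolding sum.Sigma[OF finite_lessThan ballI[OF finite_atMost]]
     sum.Sigma[OF finite_lessThan ballI[OF finite_lessThan]]
    by (rule sum.reindex_bij_witness[where j = "\<lambda>(m, t). (t, m - t)" and i = "\<lambda>(t, m). (m + t, t)"]) auto
  also have "\<dots> = (\<Sum>t<N. ?d (Suc t) * (\<Sum>m<N-t. ?S i m))"
    unfolding sum_distrib_left by (intro sum.cong refl mult.commute)
  also have "\<dots> \<le> (\<Sum>t<N. ?d (Suc t) * (\<Prod>j<i. g j))"
  proof (intro sum_mono mult_left_mono d0)
    fix t
    have "(\<Sum>m<N-t. ?S i m) \<le> (\<Sum>m\<le>N. ?S i m)"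
      by (intro sum_mono2) auto
    with Suc.IH[of N] show "(\<Sum>m<N-t. ?S i m) \<le> (\<Prod>j<i. g j)" by linarith
  qed
  also have "\<dots> = (\<Sum>t=1..N. ?d t) * (\<Prod>j<i. g j)"
    unfolding sum_distrib_right[symmetric] by (simp only: sum.atLeast1_atMost_eq One_nat_def)
  also have "\<dots> \<le> g i * (\<Prod>j<i. g j)"
  proof (rule mult_right_mono)
    have "(\<Sum>t=1..N. ?d t) = (\<Sum>t\<in>{1..N} \<inter> {..T}. ?d t)"
      by (rule sum.mono_neutral_right) (auto simp: dT)
    also have "\<dots> \<le> (\<Sum>t=1..T. ?d t)"
      by (rule sum_mono2) (use d0 in auto)
    finally show "(\<Sum>t=1..N. ?d t) \<le> g i" using g[of i] by linarith
    show "0 \<le> (\<Prod>j<i. g j)" using S0[of i "{..0}"] Suc.IH[of 0] by linarith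
  qed
  also have "g i * (\<Prod>j<i. g j) = (\<Prod>j<Suc i. g j)"
    by simp
  finally show ?case .
qed

text \<open>There are two ways to end on a bad arm. If it has at most \<open>T\<close> rewards, it
  was started no earlier than \<open>N - T\<close>, which the exponential moment makes rare. If it
  has more, it passed the check at \<open>T\<close>; a union bound over arms and starting times
  gives the second term.\<close>

lemma race_fail_le:
  fixes g :: "nat \<Rightarrow> real" and \<theta> :: real and T N :: nat
  assumes D: "\<And>w. D w \<Longrightarrow> length w \<le> T"
    and g: "\<And>i. (\<Sum>t=1..T. exp (\<theta> * t) * dead_prob D (bern_mean (p i)) t) \<le> g i"
    and acc: "\<And>i. p i < x \<Longrightarrow> (\<Sum>w\<in>{w\<in>words T. \<not> D w}. bprob (bern_mean (p i)) w) \<le> a"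
    and "0 \<le> \<theta>" "T \<le> N" "0 \<le> a" "0 < T"
  shows "measure_pmf.prob (output_dist (race_alg D) p N) {i. p i < x} \<le>
    exp (- \<theta> * (N - T)) * (\<Sum>i\<le>N. \<Prod>j<i. g j) + real (N + 1) ^ 2 * a"
proof -
  let ?c = "\<lambda>i w. pmf (race_chain D p N) (i, w)"
  let ?S = "\<lambda>i m. pmf (race_chain D p m) (i, [])"
  let ?I = "{i. i \<le> N \<and> p i < x}"
  have g0: "0 \<le> g i" for i
    by (rule order_trans[OF _ g[of i]], rule sum_nonneg) (simp add: dead_prob_nonneg)
  have arm: "(\<Sum>t\<le>N. \<Sum>w\<in>words t. ?c i w) \<le> exp (- \<theta> * (N - T)) * (\<Prod>j<i. g j) + (N + 1) * a"
    if "p i < x" for i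
  proof -
    have ct: "(\<Sum>w\<in>words t. ?c i w) =
        ?S i (N - t) * (\<Sum>w\<in>words t. if alive D w then bprob (bern_mean (p i)) w else 0)"
      if "t \<le> N" for t
      unfolding sum_distrib_left using that
      by (intro sum.cong refl, subst pmf_race_chain_eq) (auto simp: words_def)
    have bn: "0 \<le> bprob (bern_mean (p i)) w" for w by (rule bprob_nonneg) auto
    have short: "(\<Sum>w\<in>words t. ?c i w) \<le> ?S i (N - t)" if "t \<le> T" for t
    proof -
      have "(\<Sum>w\<in>words t. if alive D w then bprob (bern_mean (p i)) w else 0) \<le>
          (\<Sum>w\<in>words t. bprob (bern_mean (p i)) w)"
        by (intro sum_mono) (auto simp: bn)
      also have "\<dots> = 1" by (rule sum_bprob)
      finally show ?thesis
        using that \<open>T \<le> N\<close> by (subst ct) (auto intro: mult_left_le)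
    qed
    \<comment> \<open>An arm with more than \<open>T\<close> rewards was not dropped at its
      \<open>T\<close>-th one, and the later rewards integrate out.\<close>
    have long: "(\<Sum>w\<in>words t. ?c i w) \<le> a" if "T < t" "t \<le> N" for t
    proof -
      have "(\<Sum>w\<in>words t. if alive D w then bprob (bern_mean (p i)) w else 0) \<le>
         (\<Sum>w\<in>words t. bprob (bern_mean (p i)) w * (if D (take T w) then 0 else 1))"
        using that \<open>0 < T\<close> by (intro sum_mono) (auto simp: bn alive_def words_def)
      also have "\<dots> = (\<Sum>w\<in>words T. bprob (bern_mean (p i)) w * (if D w then 0 else 1))"
        using that by (subst sum_bprob_take) auto
      also have "\<dots> = (\<Sum>w\<in>{w\<in>words T. \<not> D w}. bprob (bern_mean (p i)) w)"
        by (auto simp: sum.inter_filter intro!: sum.cong)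
      also have "\<dots> \<le> a" by (rule acc) fact
      finally have "?S i (N - t) * (\<Sum>w\<in>words t. if alive D w then bprob (bern_mean (p i)) w else 0) \<le> 1 * a"
        by (intro mult_mono sum_nonneg) (auto simp: pmf_le_1 bn)
      then show ?thesis
        using that by (subst ct) auto
    qed
    have "(\<Sum>t\<le>N. \<Sum>w\<in>words t. ?c i w) =
        (\<Sum>t\<le>T. \<Sum>w\<in>words t. ?c i w) + (\<Sum>t\<in>{T<..N}. \<Sum>w\<in>words t. ?c i w)"
      using \<open>T \<le> N\<close> by (subst sum.union_disjoint[symmetric]) (auto intro!: sum.cong)
    also have "(\<Sum>t\<in>{T<..N}. \<Sum>w\<in>words t. ?c i w) \<le> (\<Sum>t\<in>{T<..N}. a)"
      by (intro sum_mono long) auto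
    also have "\<dots> \<le> (N + 1) * a"
      using \<open>0 \<le> a\<close> by (auto intro!: mult_right_mono)
    also have "(\<Sum>t\<le>T. \<Sum>w\<in>words t. ?c i w) \<le> (\<Sum>t\<le>T. ?S i (N - t))"
      by (intro sum_mono short) auto
    \<comment> \<open>Exponential Markov inequality: starting times from \<open>N - T\<close> on
      carry at least the weight of \<open>N - T\<close>.\<close>
    also have "\<dots> \<le> (\<Sum>t\<le>T. exp (- \<theta> * (N - T)) * (exp (\<theta> * real (N - t)) * ?S i (N - t)))"
    proof (intro sum_mono)
      fix t assume "t \<in> {..T}"
      then have "0 \<le> \<theta> * (real (N - t) - real (N - T))"
        using \<open>0 \<le> \<theta>\<close> by (intro mult_nonneg_nonneg) auto
      then have "1 \<le> exp (- \<theta> * (N - T)) * exp (\<theta> * real (N - t))"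
        by (simp add: exp_add[symmetric] algebra_simps)
      then show "?S i (N - t) \<le> exp (- \<theta> * (N - T)) * (exp (\<theta> * real (N - t)) * ?S i (N - t))"
        using mult_right_mono[OF _ pmf_nonneg[of "race_chain D p (N - t)" "(i, [])"], of 1 "exp (- \<theta> * (N - T)) * exp (\<theta> * real (N - t))"]
        by (simp add: mult.assoc)
    qed
    also have "\<dots> = exp (- \<theta> * (N - T)) * (\<Sum>m\<in>{N-T..N}. exp (\<theta> * real m) * ?S i m)"
      unfolding sum_distrib_left[symmetric] using \<open>T \<le> N\<close>
      by (intro arg_cong2[of _ _ _ _ "(*)"] refl
          sum.reindex_bij_witness[where i = "\<lambda>m. N - m" and j = "\<lambda>t. N - t"]) auto
    also have "\<dots> \<le> exp (- \<theta> * (N - T)) * (\<Sum>m\<le>N. exp (\<theta> * real m) * ?S i m)"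
      by (intro mult_left_mono sum_mono2) auto
    also have "\<dots> \<le> exp (- \<theta> * (N - T)) * (\<Prod>j<i. g j)"
      by (intro mult_left_mono exp_weighted_fresh_le[OF D g]) auto
    finally show ?thesis by simp
  qed
  have "measure_pmf.prob (output_dist (race_alg D) p N) {i. p i < x} =
      measure_pmf.prob (race_chain D p N) {s. p (fst s) < x}"
    by (simp add: output_dist_race vimage_def)
  also have "\<dots> = measure_pmf.prob (race_chain D p N) (?I \<times> (\<Union>t\<le>N. words t))"
    by (rule measure_eq_AE)
       (auto simp: AE_measure_pmf_iff words_def dest: race_chain_support)
  also have "\<dots> = (\<Sum>i\<in>?I. \<Sum>w\<in>(\<Union>t\<le>N. words t). ?c i w)"
    by (subst measure_measure_pmf_finite) (auto simp: sum.cartesian_product)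
  also have "\<dots> = (\<Sum>i\<in>?I. \<Sum>t\<le>N. \<Sum>w\<in>words t. ?c i w)"
    by (intro sum.cong refl sum_words_le)
  also have "\<dots> \<le> (\<Sum>i\<in>?I. exp (- \<theta> * (N - T)) * (\<Prod>j<i. g j) + (N + 1) * a)"
    by (intro sum_mono arm) auto
  also have "\<dots> \<le> (\<Sum>i\<le>N. exp (- \<theta> * (N - T)) * (\<Prod>j<i. g j) + (N + 1) * a)"
    using \<open>0 \<le> a\<close> by (intro sum_mono2) (auto intro!: add_nonneg_nonneg mult_nonneg_nonneg prod_nonneg simp: g0)
  also have "\<dots> = exp (- \<theta> * (N - T)) * (\<Sum>i\<le>N. \<Prod>j<i. g j) + real (N + 1) ^ 2 * a"
    unfolding sum.distrib sum_distrib_left[symmetric] by (simp add: power2_eq_square ac_simps)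
  finally show ?thesis .
qed

section \<open>Averaging over the random means\<close>

lemma nn_integral_means_prod:
  fixes G :: "real \<Rightarrow> ennreal"
  assumes "reservoir \<mu>" and [measurable]: "G \<in> borel_measurable borel"
  shows "(\<integral>\<^sup>+ p. (\<Prod>j<i. G (p j)) \<partial>means_measure \<mu>) = (\<integral>\<^sup>+ y. G y \<partial>\<mu>) ^ i"
proof -
  have sets [measurable_cong]: "sets \<mu> = sets borel" and "prob_space \<mu>"
    using assms(1) by (auto simp: reservoir_def)
  interpret prob_space \<mu> by fact
  interpret product_prob_space "\<lambda>_ :: nat. \<mu>" UNIV ..
  let ?P = "PiM {..<i} (\<lambda>_. \<mu>)"
  \<comment> \<open>Only the first \<open>i\<close> means occur, so the infinite product measure can
    be projected to a finite one.\<close>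
  have "(\<integral>\<^sup>+ p. (\<Prod>j<i. G (p j)) \<partial>means_measure \<mu>) =
      (\<integral>\<^sup>+ p. (\<Prod>j<i. G (restrict p {..<i} j)) \<partial>means_measure \<mu>)"
    by simp
  also have "\<dots> = (\<integral>\<^sup>+ p. (\<Prod>j<i. G (p j)) \<partial>distr (means_measure \<mu>) ?P (\<lambda>p. restrict p {..<i}))"
    by (subst nn_integral_distr) (auto simp: means_measure_def)
  also have "distr (means_measure \<mu>) ?P (\<lambda>p. restrict p {..<i}) = ?P"
    unfolding means_measure_def by (rule distr_PiM_restrict_finite) auto
  also have "(\<integral>\<^sup>+ p. (\<Prod>j<i. G (p j)) \<partial>?P) = (\<integral>\<^sup>+ y. G y \<partial>\<mu>) ^ i"
    by (subst product_nn_integral_prod) auto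
  finally show ?thesis .
qed

text \<open>The means are independent, so the expected product of the \<open>G (p j)\<close> is a
  power of the integral of \<open>G\<close>. Hence the exponential moment has to be at most one only
  on average over the reservoir: good arms may compensate for bad ones.\<close>

lemma fail_prob_race_le:
  fixes G :: "real \<Rightarrow> real" and \<theta> :: real and T N :: nat
  assumes "reservoir \<mu>"
    and D: "\<And>w. D w \<Longrightarrow> length w \<le> T"
    and [measurable]: "G \<in> borel_measurable borel"
    and G: "\<And>y. (\<Sum>t=1..T. exp (\<theta> * t) * dead_prob D (bern_mean y) t) \<le> G y"
    and int: "(\<integral>\<^sup>+ y. ennreal (G y) \<partial>\<mu>) \<le> 1"
    and acc: "\<And>y. y < x \<Longrightarrow> (\<Sum>w\<in>{w\<in>words T. \<not> D w}. bprob (bern_mean y) w) \<le> a"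
    and "0 \<le> \<theta>" "T \<le> N" "0 \<le> a" "0 < T"
  shows "fail_prob (race_alg D) \<mu> N x \<le> real (N + 1) * exp (- \<theta> * (N - T)) + real (N + 1) ^ 2 * a"
proof -
  let ?e = "exp (- \<theta> * (N - T))"
  have "prob_space \<mu>" and sets [measurable_cong]: "sets \<mu> = sets borel"
    using assms(1) by (auto simp: reservoir_def)
  then interpret P: prob_space "means_measure \<mu>"
    unfolding means_measure_def by (intro prob_space_PiM)
  have [measurable_cong]: "sets (means_measure \<mu>) = sets (PiM UNIV (\<lambda>_. borel))"
    unfolding means_measure_def by (intro sets_PiM_cong) (auto simp: sets)
  have G0: "0 \<le> G y" for y
    by (rule order_trans[OF _ G[of y]], rule sum_nonneg) (simp add: dead_prob_nonneg)
  let ?F = "\<integral>\<^sup>+ p. ennreal (measure_pmf.prob (output_dist (race_alg D) p N) {i. p i < x}) \<partial>means_measure \<mu>"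
  have "?F \<le> (\<integral>\<^sup>+ p. ennreal ?e * (\<Sum>i\<le>N. \<Prod>j<i. ennreal (G (p j))) + ennreal (real (N + 1) ^ 2 * a) \<partial>means_measure \<mu>)"
  proof (rule nn_integral_mono)
    fix p :: "nat \<Rightarrow> real"
    have "measure_pmf.prob (output_dist (race_alg D) p N) {i. p i < x} \<le>
        ?e * (\<Sum>i\<le>N. \<Prod>j<i. G (p j)) + real (N + 1) ^ 2 * a"
      by (rule race_fail_le) (use assms in auto)
    also have "ennreal \<dots> = ennreal ?e * (\<Sum>i\<le>N. \<Prod>j<i. ennreal (G (p j))) + ennreal (real (N + 1) ^ 2 * a)"
      using \<open>0 \<le> a\<close> G0
      by (simp add: ennreal_plus ennreal_mult prod_ennreal sum_ennreal prod_nonneg sum_nonneg del: of_nat_add)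
    finally show "ennreal (measure_pmf.prob (output_dist (race_alg D) p N) {i. p i < x}) \<le>
        ennreal ?e * (\<Sum>i\<le>N. \<Prod>j<i. ennreal (G (p j))) + ennreal (real (N + 1) ^ 2 * a)"
      by (simp add: ennreal_leI)
  qed
  also have "\<dots> = ennreal ?e * (\<Sum>i\<le>N. (\<integral>\<^sup>+ y. ennreal (G y) \<partial>\<mu>) ^ i) + ennreal (real (N + 1) ^ 2 * a)"
    using nn_integral_means_prod[OF assms(1), of "\<lambda>y. ennreal (G y)"]
    by (simp add: nn_integral_add nn_integral_cmult nn_integral_sum P.emeasure_space_1)
  also have "\<dots> \<le> ennreal ?e * (\<Sum>i\<le>N. 1) + ennreal (real (N + 1) ^ 2 * a)"
    by (intro add_mono mult_left_mono sum_mono) (auto simp: int power_le_one)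
  also have "\<dots> = ennreal (real (N + 1) * ?e + real (N + 1) ^ 2 * a)"
    using \<open>0 \<le> a\<close> by (simp add: ennreal_plus ennreal_mult mult.commute ennreal_of_nat_eq_real_of_nat)
  finally have "?F \<le> ennreal (real (N + 1) * ?e + real (N + 1) ^ 2 * a)" .
  then show ?thesis
    unfolding fail_prob_def using \<open>0 \<le> a\<close> enn2real_leI by force
qed

subsection \<open>Exponential moment bounds\<close>

text \<open>Taylor expansion with Lagrange remainder; on this range the cubic coefficient
  \<open>exp t / 6\<close> is at most 1/2.\<close>

lemma exp_le_cubic:
  fixes x :: real
  assumes "\<bar>x\<bar> \<le> 1"
  shows "exp x \<le> 1 + x + x\<^sup>2 / 2 + \<bar>x\<bar> ^ 3"
proof -
  obtain t where t: "\<bar>t\<bar> \<le> \<bar>x\<bar>" "exp x = (\<Sum>m<3. x ^ m / fact m) + exp t / fact 3 * x ^ 3"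
    using Maclaurin_exp_le by blast
  have "exp t \<le> exp 1" using t assms by simp
  also have "\<dots> \<le> 3" using exp_le by simp
  finally have "exp t \<le> 3" .
  then have "exp t / fact 3 * x ^ 3 \<le> 1 * \<bar>x\<bar> ^ 3"
  proof -
    have "exp t / fact 3 * x ^ 3 \<le> \<bar>exp t / fact 3 * x ^ 3\<bar>" by (rule abs_ge_self)
    also have "\<dots> = exp t / fact 3 * \<bar>x\<bar> ^ 3" by (simp add: abs_mult power_abs)
    also have "\<dots> \<le> 1 * \<bar>x\<bar> ^ 3"
      using \<open>exp t \<le> 3\<close> by (intro mult_right_mono) (auto simp: fact_numeral)
    finally show ?thesis .
  qed
  then show ?thesis
    using t(2) by (simp add: numeral_3_eq_3 power2_eq_square)
qed

text \<open>Centring removes the linear term. Keeping the factor \<open>q * (1 - q)\<close> also in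
  the cubic error preserves the exact variance, on which the sharp constant depends.\<close>

lemma bernoulli_mgf_le:
  fixes q h :: real
  assumes "0 \<le> q" "q \<le> 1" "\<bar>h\<bar> \<le> 1"
  shows "q * exp (h * (1 - q)) + (1 - q) * exp (- h * q) \<le> exp (q * (1 - q) * (h\<^sup>2 / 2 + \<bar>h\<bar> ^ 3))"
proof -
  have "\<bar>h * (1 - q)\<bar> \<le> 1" "\<bar>- h * q\<bar> \<le> 1"
    using assms by (auto simp: abs_mult intro!: mult_le_one)
  note e = this[THEN exp_le_cubic]
  have "q * exp (h * (1 - q)) + (1 - q) * exp (- h * q) \<le>
      q * (1 + h * (1 - q) + (h * (1 - q))\<^sup>2 / 2 + \<bar>h * (1 - q)\<bar> ^ 3) +
      (1 - q) * (1 + (- h * q) + (- h * q)\<^sup>2 / 2 + \<bar>- h * q\<bar> ^ 3)"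
    using assms e by (intro add_mono mult_left_mono) auto
  also have "\<dots> = 1 + q * (1 - q) * (h\<^sup>2 / 2) + \<bar>h\<bar> ^ 3 * (q * (1 - q) * ((1 - q)\<^sup>2 + q\<^sup>2))"
    using assms by (simp add: abs_mult power_mult_distrib) (simp add: field_simps power2_eq_square power3_eq_cube)
  also have "\<dots> \<le> 1 + q * (1 - q) * (h\<^sup>2 / 2) + \<bar>h\<bar> ^ 3 * (q * (1 - q) * 1)"
  proof -
    have "(1 - q)\<^sup>2 + q\<^sup>2 = 1 - 2 * (q * (1 - q))" by (simp add: power2_eq_square algebra_simps)
    also have "\<dots> \<le> 1" using assms by simp
    finally show ?thesis using assms by (intro add_left_mono mult_left_mono) auto
  qed
  also have "\<dots> = 1 + q * (1 - q) * (h\<^sup>2 / 2 + \<bar>h\<bar> ^ 3)" by (simp add: algebra_simps)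
  also have "\<dots> \<le> exp (q * (1 - q) * (h\<^sup>2 / 2 + \<bar>h\<bar> ^ 3))"
    by (rule exp_ge_add_one_self)
  finally show ?thesis .
qed

text \<open>Exponential tilting with a separate multiplier for each reward, since the events of
  interest constrain the whole path and not only its endpoint.\<close>

lemma bprob_chernoff:
  fixes h :: "nat \<Rightarrow> real"
  assumes "0 \<le> q" "q \<le> 1" and h: "\<And>j. j < t \<Longrightarrow> \<bar>h j\<bar> \<le> 1"
    and E: "\<And>w. w \<in> words t \<Longrightarrow> E w \<Longrightarrow> L \<le> (\<Sum>j<t. h j * (of_bool (w ! j) - q))"
  shows "(\<Sum>w\<in>{w\<in>words t. E w}. bprob q w) \<le>
    exp (q * (1 - q) * (\<Sum>j<t. (h j)\<^sup>2 / 2 + \<bar>h j\<bar> ^ 3) - L)"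
proof -
  let ?f = "\<lambda>j r. (if r then q else 1 - q) * exp (h j * (of_bool r - q))"
  have "(\<Sum>w\<in>{w\<in>words t. E w}. bprob q w) * exp L \<le>
      (\<Sum>w\<in>{w\<in>words t. E w}. bprob q w * exp (\<Sum>j<t. h j * (of_bool (w ! j) - q)))"
    unfolding sum_distrib_right using assms
    by (intro sum_mono mult_left_mono bprob_nonneg) auto
  also have "\<dots> \<le> (\<Sum>w\<in>words t. bprob q w * exp (\<Sum>j<t. h j * (of_bool (w ! j) - q)))"
    using assms by (intro sum_mono2) (auto intro!: mult_nonneg_nonneg bprob_nonneg)
  also have "\<dots> = (\<Sum>w\<in>words t. \<Prod>j<t. ?f j (w ! j))"
    by (intro sum.cong) (auto simp: bprob_def words_def exp_sum prod.distrib)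
  also have "\<dots> = (\<Prod>j<t. ?f j True + ?f j False)"
    by (rule sum_words_prod)
  also have "\<dots> \<le> (\<Prod>j<t. exp (q * (1 - q) * ((h j)\<^sup>2 / 2 + \<bar>h j\<bar> ^ 3)))"
    using assms bernoulli_mgf_le[of q "h j" for j]
    by (intro prod_mono conjI) (auto intro!: add_nonneg_nonneg mult_nonneg_nonneg)
  also have "\<dots> = exp (q * (1 - q) * (\<Sum>j<t. (h j)\<^sup>2 / 2 + \<bar>h j\<bar> ^ 3))"
    by (simp add: exp_sum sum_distrib_left)
  finally show ?thesis
    unfolding exp_diff by (simp add: pos_le_divide_eq)
qed

section \<open>Deviations of success counts\<close>

definition succs :: "bool list \<Rightarrow> real" where
  "succs w = (\<Sum>j<length w. of_bool (w ! j))"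

lemma succs_take: "m \<le> length w \<Longrightarrow> succs (take m w) = (\<Sum>j<m. of_bool (w ! j))"
  by (simp add: succs_def)

lemma succs_take_mono: "m \<le> length w \<Longrightarrow> succs (take m w) \<le> succs w"
  unfolding succs_take unfolding succs_def by (rule sum_mono2) auto

lemma sum_prefix: "m \<le> t \<Longrightarrow> (\<Sum>j<t. if j < m then f j else 0) = (\<Sum>j<m. f j)"
  for f :: "nat \<Rightarrow> real"
  by (auto simp: sum.If_cases intro!: sum.cong)

text \<open>Constant multiplier \<open>x\<close> on the first \<open>m\<close> rewards; its sign
  selects the tail. As the variance is at most 1/4, the exponent is at least 1 - 3/8 times
  \<open>m * x\<^sup>2\<close>, more than the half that is claimed.\<close>

lemma bprob_tail:
  assumes q: "0 \<le> q" "q \<le> 1" and "m \<le> t" and x: "\<bar>x\<bar> \<le> 1"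
    and E: "\<And>w. w \<in> words t \<Longrightarrow> E w \<Longrightarrow> x\<^sup>2 * m \<le> x * (succs (take m w) - m * q)"
  shows "(\<Sum>w\<in>{w\<in>words t. E w}. bprob q w) \<le> exp (- (m * x\<^sup>2 / 2))"
proof -
  have "x\<^sup>2 * m \<le> (\<Sum>j<t. (if j < m then x else 0) * (of_bool (w ! j) - q))"
    if "w \<in> words t" "E w" for w
    using E[OF that] that \<open>m \<le> t\<close>
    by (simp add: if_distrib[of "\<lambda>x. x * _"] sum_prefix succs_take words_def sum_subtractf
        sum_distrib_left[symmetric] cong: if_cong)
  then have "(\<Sum>w\<in>{w\<in>words t. E w}. bprob q w) \<le>
    exp (q * (1 - q) * (\<Sum>j<t. (if j < m then x else 0)\<^sup>2 / 2 + \<bar>if j < m then x else 0\<bar> ^ 3) - x\<^sup>2 * m)"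
    using x by (intro bprob_chernoff q) auto
  also have "\<dots> \<le> exp (- (m * x\<^sup>2 / 2))"
  proof -
    have "(\<Sum>j<t. (if j < m then x else 0)\<^sup>2 / 2 + \<bar>if j < m then x else 0\<bar> ^ 3) =
      (\<Sum>j<t. if j < m then x\<^sup>2 / 2 + \<bar>x\<bar> ^ 3 else 0)"
      by (intro sum.cong) auto
    also have "\<dots> = m * (x\<^sup>2 / 2 + \<bar>x\<bar> ^ 3)" using \<open>m \<le> t\<close> by (simp add: sum_prefix)
    also have "\<dots> \<le> m * (x\<^sup>2 / 2 + x\<^sup>2)"
    proof (intro mult_left_mono add_left_mono)
      show "\<bar>x\<bar> ^ 3 \<le> x\<^sup>2" using x power_decreasing[of 2 3 "\<bar>x\<bar>"] by simp
    qed simp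
    finally have *: "(\<Sum>j<t. (if j < m then x else 0)\<^sup>2 / 2 + \<bar>if j < m then x else 0\<bar> ^ 3) \<le> m * (x\<^sup>2 / 2 + x\<^sup>2)" .
    have "q * (1 - q) \<le> 1 / 4"
      using zero_le_power2[of "q - 1/2"] by (simp add: power2_eq_square algebra_simps)
    then have "q * (1 - q) * (\<Sum>j<t. (if j < m then x else 0)\<^sup>2 / 2 + \<bar>if j < m then x else 0\<bar> ^ 3)
        \<le> 1/4 * (m * (x\<^sup>2 / 2 + x\<^sup>2))"
      using * q by (intro mult_mono sum_nonneg) auto
    also have "\<dots> \<le> m * x\<^sup>2 / 2" by (simp add: field_simps)
    finally show ?thesis by (simp add: algebra_simps)
  qed
  finally show ?thesis .
qed

lemma bprob_tail_ge:
  assumes "0 \<le> q" "q \<le> 1" "m \<le> t" "0 \<le> x" "x \<le> 1"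
    and "\<And>w. w \<in> words t \<Longrightarrow> E w \<Longrightarrow> m * (q + x) \<le> succs (take m w)"
  shows "(\<Sum>w\<in>{w\<in>words t. E w}. bprob q w) \<le> exp (- (m * x\<^sup>2 / 2))"
proof (rule bprob_tail)
  fix w assume "w \<in> words t" "E w"
  with assms have "x * (m * x) \<le> x * (succs (take m w) - m * q)"
    by (intro mult_left_mono) (auto simp: algebra_simps)
  then show "x\<^sup>2 * m \<le> x * (succs (take m w) - m * q)" by (simp add: power2_eq_square ac_simps)
qed (use assms in auto)

lemma bprob_tail_le:
  assumes "0 \<le> q" "q \<le> 1" "m \<le> t" "0 \<le> x" "x \<le> 1"
    and "\<And>w. w \<in> words t \<Longrightarrow> E w \<Longrightarrow> succs (take m w) \<le> m * (q - x)"
  shows "(\<Sum>w\<in>{w\<in>words t. E w}. bprob q w) \<le> exp (- (m * x\<^sup>2 / 2))"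
proof -
  have "(\<Sum>w\<in>{w\<in>words t. E w}. bprob q w) \<le> exp (- (m * (- x)\<^sup>2 / 2))"
  proof (rule bprob_tail)
    fix w assume "w \<in> words t" "E w"
    with assms have "x * (m * x) \<le> x * (m * q - succs (take m w))"
      by (intro mult_left_mono) (auto simp: algebra_simps)
    then show "(- x)\<^sup>2 * m \<le> - x * (succs (take m w) - m * q)" by (simp add: power2_eq_square algebra_simps)
  qed (use assms in auto)
  then show ?thesis by simp
qed

text \<open>Passing from \<open>n\<close> to \<open>n + 1\<close> adds a row, a column and a corner,
  at most 2 in total. The sum is the second moment of the multipliers in the drift bound; it
  discretises the integral of 1 / max over the unit square, which equals 2.\<close>

lemma sum_inverse_max_le:
  "(\<Sum>k=1..n. \<Sum>l=1..n. 1 / real (max k l)) \<le> 2 * n"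
proof (induction n)
  case (Suc n)
  have max1: "(\<Sum>k=1..n. 1 / real (max k (Suc n))) = n / Suc n"
       "(\<Sum>k=1..n. 1 / real (max (Suc n) k)) = n / Suc n"
    by (simp_all add: max_absorb1 max_absorb2)
  have "(\<Sum>k=1..Suc n. \<Sum>l=1..Suc n. 1 / real (max k l)) =
      (\<Sum>k=1..n. \<Sum>l=1..n. 1 / real (max k l)) + (2 * n + 1) / Suc n"
    using max1 by (simp add: sum.distrib) (simp add: field_simps)
  also have "(2 * n + 1) / Suc n \<le> 2" by (simp add: field_simps)
  finally show ?case using Suc by simp
qed simp

text \<open>A Riemann sum for the integral of -ln over the unit interval, which equals 1, with
  explicit error. The summands are the heights of a logarithmic threshold above its final
  value.\<close>

lemma sum_ln_ratio_ge:
  assumes "0 < n"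
  shows "(\<Sum>k=1..n. ln (real n / real k)) \<ge> n - 1 - ln n"
  using assms
proof (induction n rule: nat_induct_non_zero)
  case (Suc n)
  have "(\<Sum>k=1..Suc n. ln (real (Suc n) / real k)) = (\<Sum>k=1..n. ln (real n / real k) + (ln (Suc n) - ln n))"
    using Suc by (auto simp: ln_div intro!: sum.cong)
  also have "\<dots> = (\<Sum>k=1..n. ln (real n / real k)) + n * (ln (Suc n) - ln n)"
    by (simp add: sum.distrib)
  also have "\<dots> = (\<Sum>k=1..n. ln (real n / real k)) + (n + 1) * (ln (Suc n) - ln n) - (ln (Suc n) - ln n)"
    by (simp add: algebra_simps)
  also have "(n + 1) * (ln (Suc n) - ln n) \<ge> 1"
  proof -
    have "ln (real n / Suc n) \<le> real n / Suc n - 1"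
      using Suc by (intro ln_le_minus_one) auto
    then have "1 / Suc n \<le> ln (Suc n) - ln n"
      using Suc by (simp add: ln_div field_simps)
    then show ?thesis by (simp add: field_simps)
  qed
  ultimately show ?case using Suc by linarith
qed simp

text \<open>Chernoff bound with the linear functional \<open>(\<Sum>k=1..K. X\<^sub>k\<^sub>m / k) - (K / n) X\<^sub>n\<^sub>m\<close> of the success counts, a
  discretisation of the optimal multiplier \<open>du / u\<close>. Its coefficients in the single rewards add up to
  zero, which makes the bound independent of the mean except through the variance.\<close>
lemma bprob_drift:
  fixes b :: "nat \<Rightarrow> real" and q s y :: real and K m t :: nat
  defines "n \<equiv> Suc K"
  assumes q: "0 \<le> q" "q \<le> 1" and nm: "n * m \<le> t" and y: "0 \<le> y" "y * n \<le> 1"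
    and E1: "\<And>w k. w \<in> words t \<Longrightarrow> E w \<Longrightarrow> 1 \<le> k \<Longrightarrow> k \<le> K \<Longrightarrow>
      k * m * (s + b k) \<le> succs (take (k * m) w)"
    and E2: "\<And>w. w \<in> words t \<Longrightarrow> E w \<Longrightarrow> succs (take (n * m) w) \<le> n * m * s + n"
  shows "(\<Sum>w\<in>{w\<in>words t. E w}. bprob q w) \<le>
    exp (q * (1 - q) * (1 / 2 + y * n) * y\<^sup>2 * n * m - y * (m * (\<Sum>k=1..K. b k) - K))"
proof -
  \<comment> \<open>\<open>c j\<close> is the coefficient of reward \<open>j\<close> in the weighted
    sum of the counts at the block ends \<open>k * m\<close>, and \<open>l\<close> is the average of
    \<open>c\<close> over the first \<open>n * m\<close> rewards.\<close>
  define c where "c j = (\<Sum>k=1..K. if j < k * m then 1 / real k else 0)" for j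
  define l where "l = K / n"
  define h where "h j = (if j < n * m then y * (c j - l) else 0)" for j
  have l: "0 \<le> l" "l \<le> 1" "l * n = K" by (auto simp: l_def n_def)
  have c0: "0 \<le> c j" for j unfolding c_def by (intro sum_nonneg) auto
  have cK: "c j \<le> K" for j
  proof -
    have "c j \<le> (\<Sum>k=1..K. 1)" unfolding c_def by (intro sum_mono) auto
    then show ?thesis by simp
  qed
  have cl: "\<bar>c j - l\<bar> \<le> n" for j
    using c0[of j] cK[of j] l by (auto simp: n_def)
  have h_le: "\<bar>h j\<bar> \<le> y * n" for j
    using cl[of j] y by (auto simp: h_def abs_mult intro!: mult_left_mono)
  have sum_c: "(\<Sum>j<n * m. c j * f j) = (\<Sum>k=1..K. (\<Sum>j<k * m. f j) / k)" for f
  proof -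
    have "(\<Sum>j<n * m. c j * f j) = (\<Sum>k=1..K. \<Sum>j<n * m. if j < k * m then f j / k else 0)"
      unfolding c_def sum_distrib_right by (subst sum.swap) (auto intro!: sum.cong)
    also have "\<dots> = (\<Sum>k=1..K. \<Sum>j<k * m. f j / k)"
      by (intro sum.cong refl sum_prefix mult_right_mono) (auto simp: n_def)
    finally show ?thesis by (simp add: sum_divide_distrib)
  qed
  have sum_h: "(\<Sum>j<t. h j * f j) = y * ((\<Sum>k=1..K. (\<Sum>j<k * m. f j) / k) - l * (\<Sum>j<n * m. f j))" for f
  proof -
    have "(\<Sum>j<t. h j * f j) = (\<Sum>j<t. if j < n * m then y * (c j - l) * f j else 0)"
      by (intro sum.cong) (auto simp: h_def)
    also have "\<dots> = y * ((\<Sum>j<n * m. c j * f j) - l * (\<Sum>j<n * m. f j))"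
      using nm by (simp add: sum_prefix sum_distrib_left sum_subtractf[symmetric] algebra_simps)
    finally show ?thesis by (simp add: sum_c)
  qed
  have km: "(\<Sum>k=1..K. real (k * m) / k) = K * m"
  proof -
    have "(\<Sum>k=1..K. real (k * m) / k) = (\<Sum>k=1..K. real m)" by (intro sum.cong) auto
    then show ?thesis by simp
  qed
  have h2: "(\<Sum>j<t. (h j)\<^sup>2) \<le> y\<^sup>2 * n * m"
  proof -
    have c1: "(\<Sum>j<n * m. c j) = K * m" using sum_c[of "\<lambda>_. 1"] km by simp
    have c2: "(\<Sum>j<n * m. c j * c j) \<le> 2 * K * m"
    proof -
      have "(\<Sum>j<k * m. c j) / k = m * (\<Sum>i=1..K. 1 / real (max k i))" if "k \<in> {1..K}" for k
      proof -
        have "(\<Sum>j<k * m. c j) = (\<Sum>i=1..K. \<Sum>j<k * m. if j < i * m then 1 / real i else 0)"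
          unfolding c_def by (rule sum.swap)
        also have "\<dots> = (\<Sum>i=1..K. m * (k / real (max k i)))"
        proof (rule sum.cong[OF refl])
          fix i assume i: "i \<in> {1..K}"
          have "(\<Sum>j<k * m. if j < i * m then 1 / real i else 0) = (\<Sum>j<min k i * m. 1 / real i)"
          proof -
            have "{..<k * m} \<inter> {j. j < i * m} = {..<min k i * m}"
              using less_le_trans[OF _ mult_le_mono1, of _ k m i] less_le_trans[OF _ mult_le_mono1, of _ i m k]
              by (cases "k \<le> i") (auto simp: min_def)
            then show ?thesis by (simp add: sum.If_cases)
          qed
          also have "\<dots> = m * (k / real (max k i))"
            using i that by (auto simp: min_def max_def)
          finally show "(\<Sum>j<k * m. if j < i * m then 1 / real i else 0) = m * (k / real (max k i))" .
        qed
        finally show ?thesis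
          using that by (simp add: sum_distrib_left sum_divide_distrib)
      qed
      then have "(\<Sum>j<n * m. c j * c j) = m * (\<Sum>k=1..K. \<Sum>i=1..K. 1 / real (max k i))"
        unfolding sum_c sum_distrib_left[of "real m" _ "{1..K}", where f = "\<lambda>k. \<Sum>i=1..K. 1 / real (max k i)"]
        by (intro sum.cong) auto
      also have "\<dots> \<le> real m * real (2 * K)"
        by (intro mult_left_mono sum_inverse_max_le) auto
      finally show ?thesis by (simp add: mult.commute)
    qed
    have "(\<Sum>j<t. (h j)\<^sup>2) = (\<Sum>j<t. if j < n * m then y\<^sup>2 * (c j - l)\<^sup>2 else 0)"
      by (intro sum.cong) (auto simp: h_def power_mult_distrib)
    also have "\<dots> = y\<^sup>2 * (\<Sum>j<n * m. (c j - l)\<^sup>2)"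
      using nm by (simp add: sum_prefix sum_distrib_left)
    finally have sq: "(\<Sum>j<t. (h j)\<^sup>2) = y\<^sup>2 * (\<Sum>j<n * m. (c j - l)\<^sup>2)" .
    \<comment> \<open>Second moment about the average \<open>l\<close>. The final bound
      \<open>K * (2 - l) \<le> n\<close> amounts to \<open>(n - K)\<^sup>2 \<ge> 0\<close>.\<close>
    have "(\<Sum>j<n * m. (c j - l)\<^sup>2) =
        (\<Sum>j<n * m. c j * c j) - 2 * l * (\<Sum>j<n * m. c j) + l\<^sup>2 * (n * m)"
      by (simp add: power2_eq_square algebra_simps sum.distrib sum_subtractf sum_distrib_left)
    also have "\<dots> \<le> 2 * K * m - 2 * l * (K * m) + l\<^sup>2 * (n * m)"
      using c2 by (simp add: c1)
    also have "l\<^sup>2 * (n * m) = l * (K * m)"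
      using l by (simp add: power2_eq_square mult.assoc[symmetric])
    also have "2 * K * m - 2 * l * (K * m) + l * (K * m) = m * (K * (2 - l))"
      by (simp add: algebra_simps)
    also have "\<dots> \<le> real m * real n"
    proof (rule mult_left_mono)
      show "K * (2 - l) \<le> n" by (simp add: l_def n_def field_simps)
    qed simp
    finally have "y\<^sup>2 * (\<Sum>j<n * m. (c j - l)\<^sup>2) \<le> y\<^sup>2 * (real m * real n)"
      by (rule mult_left_mono) simp
    then show ?thesis by (simp add: sq ac_simps)
  qed
  have "(\<Sum>w\<in>{w\<in>words t. E w}. bprob q w) \<le>
    exp (q * (1 - q) * (\<Sum>j<t. (h j)\<^sup>2 / 2 + \<bar>h j\<bar> ^ 3) - y * (m * (\<Sum>k=1..K. b k) - K))"
  proof (rule bprob_chernoff[OF q])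
    show "\<bar>h j\<bar> \<le> 1" for j using h_le[of j] y by simp
    fix w assume w: "w \<in> words t" "E w"
    have X: "(\<Sum>j<i * m. of_bool (w ! j) - q) = succs (take (i * m) w) - i * m * q" if "i \<le> n" for i
    proof -
      have "i * m \<le> length w"
        using order_trans[OF mult_le_mono1[OF that] nm] w by (simp add: words_def)
      then show ?thesis by (simp add: succs_take sum_subtractf)
    qed
    have "m * (s + b k - q) \<le> (\<Sum>j<k * m. of_bool (w ! j) - q) / k" if "k \<in> {1..K}" for k
      using E1[OF w, of k] that by (subst X) (auto simp: n_def field_simps)
    then have "(\<Sum>k=1..K. m * (s + b k - q)) \<le> (\<Sum>k=1..K. (\<Sum>j<k * m. of_bool (w ! j) - q) / k)"
      by (rule sum_mono)
    moreover have "l * (\<Sum>j<n * m. of_bool (w ! j) - q) \<le> l * (n * m * s + n - n * m * q)"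
      using E2[OF w] l by (subst X) (auto intro!: mult_left_mono)
    moreover have "l * (n * m * s + n - n * m * q) = (l * n) * (m * s + 1 - m * q)"
      by (simp add: algebra_simps)
    \<comment> \<open>The multiples of \<open>s - q\<close> cancel against those at the endpoint
      because \<open>l * n = K\<close>; here the mean disappears. The slack \<open>n\<close> at the
      endpoint costs the term \<open>K\<close>.\<close>
    moreover have "(\<Sum>k=1..K. m * (s + b k - q)) = K * (m * (s - q)) + m * (\<Sum>k=1..K. b k)"
      by (simp add: algebra_simps sum.distrib sum_subtractf sum_distrib_left)
    ultimately have "m * (\<Sum>k=1..K. b k) - K \<le>
        (\<Sum>k=1..K. (\<Sum>j<k * m. of_bool (w ! j) - q) / k) - l * (\<Sum>j<n * m. of_bool (w ! j) - q)"
      unfolding l(3) by (simp add: algebra_simps)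
    then show "y * (m * (\<Sum>k=1..K. b k) - K) \<le> (\<Sum>j<t. h j * (of_bool (w ! j) - q))"
      unfolding sum_h by (intro mult_left_mono y)
  qed
  also have "\<dots> \<le> exp (q * (1 - q) * ((1 / 2 + y * n) * (y\<^sup>2 * n * m)) - y * (m * (\<Sum>k=1..K. b k) - K))"
  proof -
    have "(\<Sum>j<t. (h j)\<^sup>2 / 2 + \<bar>h j\<bar> ^ 3) \<le> (\<Sum>j<t. (1 / 2 + y * n) * (h j)\<^sup>2)"
    proof (rule sum_mono)
      fix j
      have "\<bar>h j\<bar> ^ 3 = \<bar>h j\<bar> * (h j)\<^sup>2" by (simp add: power3_eq_cube power2_eq_square flip: abs_mult)
      also have "\<dots> \<le> y * n * (h j)\<^sup>2" by (intro mult_right_mono h_le) auto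
      finally show "(h j)\<^sup>2 / 2 + \<bar>h j\<bar> ^ 3 \<le> (1 / 2 + y * n) * (h j)\<^sup>2" by (simp add: algebra_simps)
    qed
    also have "\<dots> \<le> (1 / 2 + y * n) * (y\<^sup>2 * n * m)"
      unfolding sum_distrib_left[symmetric] using h2 y by (intro mult_left_mono) auto
    finally show ?thesis using q by (auto intro!: mult_left_mono)
  qed
  finally show ?thesis by (simp add: mult.assoc)
qed

subsection \<open>The dropping time of an arm\<close>

text \<open>The early check at time \<open>t0\<close>, with a higher bar \<open>x\<close>, makes it unlikely to be dropped at the
  moderate times for which the drift bound is still too weak.\<close>
definition race_rule :: "real \<Rightarrow> (nat \<Rightarrow> real) \<Rightarrow> nat \<Rightarrow> nat \<Rightarrow> nat \<Rightarrow> bool list \<Rightarrow> bool" where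
  "race_rule x s t0 t1 T w \<longleftrightarrow>
     length w = t0 \<and> succs w < real t0 * x \<or>
     t1 \<le> length w \<and> length w \<le> T \<and> succs w < real (length w) * s (length w)"

lemma not_dead_take:
  assumes "first_dead D w" "0 < u" "u < length w"
  shows "\<not> D (take u w)"
  using assms by (cases w rule: rev_cases) (auto simp: first_dead_def alive_def)

lemma dead_prob_eq_0:
  assumes "t \<noteq> t0" "t < t1"
  shows "dead_prob (race_rule x s t0 t1 T) q t = 0"
proof -
  have "{w \<in> words t. first_dead (race_rule x s t0 t1 T) w} = {}"
    using assms by (auto simp: first_dead_def race_rule_def words_def)
  then show ?thesis unfolding dead_prob_def by (metis sum.empty)
qed

lemma dead_prob_le_1:
  assumes "0 \<le> q" "q \<le> 1"
  shows "dead_prob D q t \<le> 1"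
proof -
  have "dead_prob D q t \<le> (\<Sum>w\<in>words t. bprob q w)"
    unfolding dead_prob_def using assms by (intro sum_mono2) (auto intro: bprob_nonneg)
  then show ?thesis by (simp add: sum_bprob)
qed

lemma dead_prob_first_check:
  assumes "0 \<le> q" "q \<le> 1" "t0 < t1" "0 \<le> d" "d \<le> 1" "x + d \<le> q"
  shows "dead_prob (race_rule x s t0 t1 T) q t0 \<le> exp (- (t0 * d\<^sup>2 / 2))"
  unfolding dead_prob_def
proof (rule bprob_tail_le)
  fix w assume w: "w \<in> words t0" "first_dead (race_rule x s t0 t1 T) w"
  then have "succs w \<le> t0 * x"
    using assms by (auto simp: first_dead_def race_rule_def words_def)
  also have "\<dots> \<le> t0 * (q - d)" using assms by (intro mult_left_mono) auto
  finally show "succs (take t0 w) \<le> t0 * (q - d)" using w by (simp add: words_def)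
qed (use assms in auto)

text \<open>On either side of \<open>x - d\<close>, the mean must be missed by at least
  \<open>d\<close>: a higher one at time \<open>t\<close>, a lower one when passing the check at
  \<open>t0\<close>. The latter involves only \<open>t0\<close> rewards, which sets the
  exponent.\<close>

lemma dead_prob_gap:
  assumes q: "0 \<le> q" "q \<le> 1" and t: "0 < t0" "t0 < t1" "t1 \<le> t"
    and d: "0 \<le> d" "d \<le> 1" and gap: "s t + 2 * d \<le> x"
  shows "dead_prob (race_rule x s t0 t1 T) q t \<le> exp (- (t0 * d\<^sup>2 / 2))"
proof (cases "x - d \<le> q")
  case True
  have "dead_prob (race_rule x s t0 t1 T) q t \<le> exp (- (t * d\<^sup>2 / 2))"
    unfolding dead_prob_def
  proof (rule bprob_tail_le)
    fix w assume w: "w \<in> words t" "first_dead (race_rule x s t0 t1 T) w"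
    then have "succs w \<le> t * s t"
      using t by (auto simp: first_dead_def race_rule_def words_def)
    also have "\<dots> \<le> t * (q - d)" using gap True by (intro mult_left_mono) auto
    finally show "succs (take t w) \<le> t * (q - d)" using w by (simp add: words_def)
  qed (use assms in auto)
  also have "\<dots> \<le> exp (- (t0 * d\<^sup>2 / 2))" using t by (simp add: mult_right_mono)
  finally show ?thesis .
next
  case False
  show ?thesis unfolding dead_prob_def
  proof (rule bprob_tail_ge)
    fix w assume w: "w \<in> words t" "first_dead (race_rule x s t0 t1 T) w"
    have "\<not> race_rule x s t0 t1 T (take t0 w)"
      using w t by (intro not_dead_take) (auto simp: words_def)
    then have "t0 * x \<le> succs (take t0 w)"
      using w t by (auto simp: race_rule_def words_def)
    moreover have "t0 * (q + d) \<le> t0 * x" using False by (intro mult_left_mono) auto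
    ultimately show "t0 * (q + d) \<le> succs (take t0 w)" by linarith
  qed (use assms in auto)
qed

text \<open>A mean above the threshold is missed by \<open>d\<close> at time \<open>t\<close>. A
  mean below it is missed at the check before, which was passed with \<open>t - 1\<close> rewards
  against a threshold that was no lower.\<close>

lemma dead_prob_far:
  assumes q: "0 \<le> q" "q \<le> 1" and t: "t0 < t1" "0 < t1" "t1 < t" "t \<le> T"
    and d: "0 \<le> d" "d \<le> 1" and far: "d \<le> \<bar>q - s t\<bar>" and s: "s t \<le> s (t - 1)"
  shows "dead_prob (race_rule x s t0 t1 T) q t \<le> exp (- (real (t - 1) * d\<^sup>2 / 2))"
proof (cases "s t \<le> q")
  case True
  have "dead_prob (race_rule x s t0 t1 T) q t \<le> exp (- (t * d\<^sup>2 / 2))"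
    unfolding dead_prob_def
  proof (rule bprob_tail_le)
    fix w assume w: "w \<in> words t" "first_dead (race_rule x s t0 t1 T) w"
    then have "succs w \<le> t * s t"
      using t by (auto simp: first_dead_def race_rule_def words_def)
    also have "\<dots> \<le> t * (q - d)" using far True by (intro mult_left_mono) auto
    finally show "succs (take t w) \<le> t * (q - d)" using w by (simp add: words_def)
  qed (use assms in auto)
  also have "\<dots> \<le> exp (- (real (t - 1) * d\<^sup>2 / 2))" by (simp add: mult_right_mono)
  finally show ?thesis .
next
  case False
  show ?thesis
    unfolding dead_prob_def
  proof (rule bprob_tail_ge)
    fix w assume w: "w \<in> words t" "first_dead (race_rule x s t0 t1 T) w"
    have "\<not> race_rule x s t0 t1 T (take (t - 1) w)"
      using w t by (intro not_dead_take) (auto simp: words_def)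
    then have "real (t - 1) * s (t - 1) \<le> succs (take (t - 1) w)"
      using w t by (auto simp: race_rule_def words_def)
    moreover have "real (t - 1) * (q + d) \<le> real (t - 1) * s (t - 1)"
      using False far s by (intro mult_left_mono) auto
    ultimately show "real (t - 1) * (q + d) \<le> succs (take (t - 1) w)" by linarith
  qed (use assms in auto)
qed

section \<open>The moving threshold in the angle coordinate\<close>

lemma cos_add_le:
  fixes p z :: real
  assumes "0 \<le> z"
  shows "z * sin p - z\<^sup>2 / 2 \<le> cos p - cos (p + z)"
proof -
  \<comment> \<open>\<open>?f\<close> vanishes to first order at 0, and its second derivative
    \<open>cos (p + u) + 1\<close> is nonnegative.\<close>
  let ?f = "\<lambda>z. cos p - cos (p + z) - z * sin p + z\<^sup>2 / 2"
  have "?f 0 \<le> ?f z"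
  proof (rule DERIV_nonneg_imp_nondecreasing[OF assms])
    fix u :: real assume "0 \<le> u"
    have "sin (p + 0) - sin p + 0 \<le> sin (p + u) - sin p + u"
    proof (rule DERIV_nonneg_imp_nondecreasing[OF \<open>0 \<le> u\<close>])
      fix v :: real
      have "((\<lambda>u. sin (p + u) - sin p + u) has_real_derivative (cos (p + v) + 1)) (at v)"
        by (auto intro!: derivative_eq_intros)
      moreover have "0 \<le> cos (p + v) + 1"
        using cos_ge_minus_one[of "p + v"] by linarith
      ultimately show "\<exists>y. ((\<lambda>u. sin (p + u) - sin p + u) has_real_derivative y) (at v) \<and> 0 \<le> y"
        by blast
    qed
    then have "0 \<le> sin (p + u) - sin p + u" by simp
    moreover have "(?f has_real_derivative (sin (p + u) - sin p + u)) (at u)"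
      by (auto intro!: derivative_eq_intros)
    ultimately show "\<exists>y. (?f has_real_derivative y) (at u) \<and> 0 \<le> y" by blast
  qed
  then show ?thesis by simp
qed

text \<open>For angles in [0,pi] the derivative of the mean in the angle is half the sine, the
  standard deviation of a reward with that mean. So the threshold falls by \<open>D\<close> standard
  deviations per unit of \<open>ln t\<close> at every height.\<close>

definition threshold :: "real \<Rightarrow> real \<Rightarrow> nat \<Rightarrow> real" where
  "threshold \<phi> D t = (1 - cos (\<phi> - D * ln t)) / 2"

text \<open>The drift bound is applied at the multiples of \<open>m\<close>. The last assumption
  collects the errors: \<open>d / v\<close> for using the variance at \<open>s\<close> in place of
  \<open>q\<close>, \<open>D / sqrt v * n\<close> for the cubic term, the squared logarithm for the
  curvature of the cosine, and \<open>1 + ln n\<close> for the discretisation. When all are small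
  compared with \<open>n\<close>, any \<open>\<kappa> < 1 / 2\<close> is admissible.\<close>

lemma dead_prob_near:
  fixes \<phi> D q v d \<kappa> :: real and K m t t0 t1 T :: nat
  defines "n \<equiv> Suc K" and "s \<equiv> threshold \<phi> D t"
  assumes q: "0 \<le> q" "q \<le> 1" and t: "t0 < t1" "0 < t1" "2 * n * t1 \<le> t" "t \<le> T"
    and sin: "0 < sin (\<phi> - D * ln t)" and v: "0 < v" "v \<le> s * (1 - s)" and "0 < D"
    and near: "\<bar>q - s\<bar> \<le> d"
    and Y: "D / sqrt v * n \<le> 1" "D\<^sup>2 * n \<le> 1"
    and \<kappa>: "0 \<le> \<kappa>" "\<kappa> \<le> 1"
      "n * ((1 + d / v) * (1 / 2 + D / sqrt v * n) + D / sqrt v * (ln (2 * n))\<^sup>2 / 4 + \<kappa>) \<le> n - 1 - ln n"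
  shows "dead_prob (race_rule x (threshold \<phi> D) t0 t1 T) q t \<le> exp (2 - \<kappa> * D\<^sup>2 * t)"
proof -
  define m where "m = t div n"
  define \<sigma> where "\<sigma> = sin (\<phi> - D * ln t) / 2"
  \<comment> \<open>To leading order the exponent per reward is
    \<open>y * \<sigma> * D - y\<^sup>2 * \<sigma>\<^sup>2 / 2\<close>, which is maximal at this
    \<open>y\<close> with value \<open>D\<^sup>2 / 2\<close>.\<close>
  define y where "y = D / \<sigma>"
  define e where "e = D\<^sup>2 * (ln (2 * n))\<^sup>2 / 4"
  define b where "b k = \<sigma> * D * ln (n / k) - e" for k :: nat
  have n: "0 < n" by (simp add: n_def)
  have s01: "0 \<le> s" "s \<le> 1" by (auto simp: s_def threshold_def)
  have \<sigma>2: "\<sigma>\<^sup>2 = s * (1 - s)"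
    using sin_squared_eq[of "\<phi> - D * ln t"]
    by (simp add: \<sigma>_def s_def threshold_def power_divide power2_eq_square field_simps)
  have "0 < \<sigma>" using sin by (simp add: \<sigma>_def)
  have "sqrt v \<le> \<sigma>" using \<sigma>2 v \<open>0 < \<sigma>\<close> by (metis real_sqrt_le_mono real_sqrt_unique less_imp_le)
  then have y: "0 < y" "y \<le> D / sqrt v"
    using \<open>0 < D\<close> v \<open>0 < \<sigma>\<close> by (auto simp: y_def intro!: divide_left_mono)
  have "y * n \<le> D / sqrt v * n" using y by (intro mult_right_mono) auto
  then have yn: "y * n \<le> 1" using Y by linarith
  have nm: "n * m \<le> t" "t < n * m + n"
    using n dividend_less_div_times[of n t] by (auto simp: m_def mult.commute[of n] add.commute)
  have tnm: "real t \<le> real (n * m + n)" using nm(2) by (simp only: of_nat_le_iff)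
  \<comment> \<open>Even the first block end is not before \<open>t1\<close>, so the threshold is in
    force at all of them.\<close>
  have "2 * t1 \<le> m"
    using t n by (simp add: m_def less_eq_div_iff_mult_less_eq ac_simps)
  then have m1: "t1 \<le> m" "1 \<le> m" using t by auto
  have "dead_prob (race_rule x (threshold \<phi> D) t0 t1 T) q t \<le>
    exp (q * (1 - q) * (1 / 2 + y * Suc K) * y\<^sup>2 * Suc K * m - y * (m * (\<Sum>k=1..K. b k) - K))"
    unfolding dead_prob_def
  proof (rule bprob_drift[OF q, where s = s])
    show "Suc K * m \<le> t" "0 \<le> y" "y * Suc K \<le> 1" using nm y yn by (auto simp: n_def)
    fix w assume w: "w \<in> words t" "first_dead (race_rule x (threshold \<phi> D) t0 t1 T) w"
    show "succs (take (Suc K * m) w) \<le> Suc K * m * s + Suc K"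
    proof -
      have "t1 \<le> t" using m1 nm n t by (cases n) auto
      have "succs (take (Suc K * m) w) \<le> succs w"
        using w nm by (intro succs_take_mono) (simp add: words_def n_def)
      also have "\<dots> \<le> t * s"
        using w t \<open>t1 \<le> t\<close> by (auto simp: first_dead_def race_rule_def words_def s_def)
      also have "\<dots> \<le> real (n * m + n) * s"
        using s01 by (intro mult_right_mono tnm)
      also have "\<dots> \<le> real (n * m) * s + real n * 1"
        unfolding of_nat_add distrib_right using s01 by (intro add_mono mult_left_mono) auto
      finally show ?thesis by (simp add: n_def)
    qed
    fix k :: nat assume k: "1 \<le> k" "k \<le> K"
    have "m \<le> k * m" using k by simp
    have km: "t1 \<le> k * m" "0 < k * m" using m1 \<open>m \<le> k * m\<close> by linarith+
    have "k * m < n * m" using k m1 by (intro mult_strict_right_mono) (auto simp: n_def)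
    then have kmt: "k * m < t" using nm by linarith
    have kmt': "real k * real m \<le> real t" using kmt by (simp flip: of_nat_mult)
    define z where "z = D * ln (t / (k * m))"
    have "real n / k \<le> t / (k * m)"
    proof -
      have "real n / k = (n * m) / (k * m)" using m1 by simp
      also have "\<dots> \<le> t / (k * m)"
        using nm(1) by (intro divide_right_mono) (simp_all flip: of_nat_mult)
      finally show ?thesis .
    qed
    then have z_ge: "D * ln (n / k) \<le> z"
      unfolding z_def using k n km kmt \<open>0 < D\<close>
      by (intro mult_left_mono, subst ln_le_cancel_iff) auto
    \<comment> \<open>Rounding \<open>t\<close> down to \<open>n * m\<close> at most halves it;
      hence the \<open>ln (2 * n)\<close> in \<open>e\<close>.\<close>
    have "t / (k * m) \<le> 2 * n"
    proof -
      have "t \<le> 2 * n * m" using nm m1 n mult_le_mono2[of 1 m n] by linarith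
      also have "\<dots> \<le> 2 * n * (k * m)" using k by simp
      finally have "real t \<le> 2 * n * (k * m)" by (metis of_nat_le_iff)
      then show ?thesis using km(2) by (simp add: pos_divide_le_eq)
    qed
    then have z_le: "z \<le> D * ln (2 * n)"
      unfolding z_def using km kmt \<open>0 < D\<close> n
      by (intro mult_left_mono, subst ln_le_cancel_iff) auto
    have z0: "0 \<le> z" unfolding z_def using km kmt' \<open>0 < D\<close> by (intro mult_nonneg_nonneg) auto
    have "z\<^sup>2 / 4 \<le> e"
      using power_mono[OF z_le z0, of 2] by (simp add: e_def power_mult_distrib)
    have "\<sigma> * (D * ln (n / k)) \<le> \<sigma> * z" using z_ge \<open>0 < \<sigma>\<close> by (intro mult_left_mono) auto
    have "\<phi> - D * ln (k * m) = \<phi> - D * ln t + z"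
      using km kmt by (simp add: z_def ln_div ln_mult algebra_simps)
    then have "threshold \<phi> D (k * m) - s = (cos (\<phi> - D * ln t) - cos (\<phi> - D * ln t + z)) / 2"
      by (simp add: threshold_def s_def field_simps)
    also have "\<dots> \<ge> \<sigma> * z - z\<^sup>2 / 4"
      using cos_add_le[OF z0, of "\<phi> - D * ln t"] by (simp add: \<sigma>_def field_simps)
    finally have "s + b k \<le> threshold \<phi> D (k * m)"
      using \<open>z\<^sup>2 / 4 \<le> e\<close> \<open>\<sigma> * (D * ln (n / k)) \<le> \<sigma> * z\<close> by (simp add: b_def mult.assoc)
    then have "k * m * (s + b k) \<le> (k * m) * threshold \<phi> D (k * m)"
      by (simp add: mult_left_mono)
    also have "\<dots> \<le> succs (take (k * m) w)"
    proof -
      have "\<not> race_rule x (threshold \<phi> D) t0 t1 T (take (k * m) w)"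
        using w km kmt by (intro not_dead_take) (auto simp: words_def)
      then show ?thesis
        using w km kmt t by (auto simp: race_rule_def words_def)
    qed
    finally show "k * m * (s + b k) \<le> succs (take (k * m) w)" .
  qed
  \<comment> \<open>The additive 2 absorbs \<open>y * K \<le> 1\<close>, from the slack in the
    counts, and \<open>\<kappa> * D\<^sup>2 * n \<le> 1\<close>, from rounding
    \<open>t\<close>.\<close>
  also have "\<dots> \<le> exp (2 - \<kappa> * D\<^sup>2 * t)"
  proof -
    define Y where "Y = D / sqrt v"
    have Y0: "0 < Y" "y \<le> Y" using y by (auto simp: Y_def)
    have q\<sigma>: "q * (1 - q) \<le> \<sigma>\<^sup>2 * (1 + d / v)"
    proof -
      have "q * (1 - q) - s * (1 - s) = (q - s) * (1 - q - s)" by (simp add: algebra_simps)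
      also have "\<dots> \<le> \<bar>q - s\<bar> * \<bar>1 - q - s\<bar>" by (simp flip: abs_mult)
      also have "\<dots> \<le> d * 1" using near q s01 by (intro mult_mono) auto
      finally have "q * (1 - q) \<le> \<sigma>\<^sup>2 + d" by (simp add: \<sigma>2)
      also have "d \<le> \<sigma>\<^sup>2 * (d / v)"
      proof -
        have "v * (d / v) \<le> \<sigma>\<^sup>2 * (d / v)"
          using v near by (intro mult_right_mono) (auto simp: \<sigma>2)
        then show ?thesis using v by simp
      qed
      finally show ?thesis by (simp add: algebra_simps)
    qed
    have dv: "0 \<le> d / v" using near v by simp
    have A: "n - 1 - ln n \<le> (\<Sum>k=1..K. ln (n / k))"
      using sum_ln_ratio_ge[OF n] by (simp add: n_def)
    have "\<sigma> * y = D" using \<open>0 < \<sigma>\<close> by (simp add: y_def)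
    then have \<sigma>y: "\<sigma>\<^sup>2 * y\<^sup>2 = D\<^sup>2" by (simp flip: power_mult_distrib)
    have 1: "q * (1 - q) * (1 / 2 + y * n) * y\<^sup>2 * n * m \<le> n * m * D\<^sup>2 * ((1 + d / v) * (1 / 2 + Y * n))"
    proof -
      have "q * (1 - q) * (1 / 2 + y * n) * y\<^sup>2 * n * m \<le>
          (\<sigma>\<^sup>2 * (1 + d / v)) * (1 / 2 + Y * n) * y\<^sup>2 * n * m"
        using q\<sigma> q Y0 y dv by (intro mult_right_mono mult_mono[OF q\<sigma>] add_left_mono) auto
      also have "\<dots> = n * m * (\<sigma>\<^sup>2 * y\<^sup>2) * ((1 + d / v) * (1 / 2 + Y * n))"
        by (simp add: algebra_simps)
      finally show ?thesis by (simp add: \<sigma>y)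
    qed
    have 2: "y * (m * (\<Sum>k=1..K. b k)) \<ge> m * D\<^sup>2 * (n - 1 - ln n) - n * m * D\<^sup>2 * (Y * (ln (2 * n))\<^sup>2 / 4)"
    proof -
      have "y * (m * (\<Sum>k=1..K. b k)) = m * (D * (\<sigma> * y)) * (\<Sum>k=1..K. ln (n / k)) - y * (m * (K * e))"
        by (simp add: b_def sum_subtractf sum_distrib_left algebra_simps)
      also have "\<dots> = m * D\<^sup>2 * (\<Sum>k=1..K. ln (n / k)) - y * (m * (K * e))"
        unfolding \<open>\<sigma> * y = D\<close> by (simp add: power2_eq_square)
      also have "m * D\<^sup>2 * (\<Sum>k=1..K. ln (n / k)) \<ge> m * D\<^sup>2 * (n - 1 - ln n)"
        using A by (intro mult_left_mono) auto
      moreover have "y * (m * (K * e)) \<le> Y * (m * (n * e))"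
        using Y0 y by (intro mult_mono) (auto simp: e_def n_def)
      moreover have "Y * (m * (n * e)) = n * m * D\<^sup>2 * (Y * (ln (2 * n))\<^sup>2 / 4)"
        by (simp add: e_def)
      ultimately show ?thesis by linarith
    qed
    have 3: "y * K \<le> 1"
    proof -
      have "y * K \<le> y * n" using y by (intro mult_left_mono) (auto simp: n_def)
      then show ?thesis using yn by linarith
    qed
    have 4: "m * D\<^sup>2 * (n * ((1 + d / v) * (1 / 2 + Y * n) + Y * (ln (2 * n))\<^sup>2 / 4 + \<kappa>)) \<le> m * D\<^sup>2 * (n - 1 - ln n)"
      using \<kappa> by (intro mult_left_mono) (auto simp: Y_def)
    have 5: "\<kappa> * D\<^sup>2 * t \<le> \<kappa> * D\<^sup>2 * (n * m) + 1"
    proof -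
      have "\<kappa> * D\<^sup>2 * t \<le> \<kappa> * D\<^sup>2 * real (n * m + n)"
        using \<kappa> by (intro mult_left_mono tnm) auto
      also have "\<dots> = \<kappa> * D\<^sup>2 * (n * m) + \<kappa> * (D\<^sup>2 * n)" by (simp add: algebra_simps)
      also have "\<kappa> * (D\<^sup>2 * n) \<le> 1" using mult_mono[OF \<kappa>(2) Y(2)] by simp
      finally show ?thesis by simp
    qed
    have 6: "m * D\<^sup>2 * (n * ((1 + d / v) * (1 / 2 + Y * n) + Y * (ln (2 * n))\<^sup>2 / 4 + \<kappa>)) =
       n * m * D\<^sup>2 * ((1 + d / v) * (1 / 2 + Y * n)) + n * m * D\<^sup>2 * (Y * (ln (2 * n))\<^sup>2 / 4)
       + \<kappa> * D\<^sup>2 * (n * m)"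
      by (simp add: algebra_simps)
    have "y * (m * (\<Sum>k=1..K. b k) - K) = y * (m * (\<Sum>k=1..K. b k)) - y * K"
      by (simp add: algebra_simps)
    then have "q * (1 - q) * (1 / 2 + y * n) * y\<^sup>2 * n * m - y * (m * (\<Sum>k=1..K. b k) - K) \<le> 2 - \<kappa> * D\<^sup>2 * t"
      using 1 2 3 4 5 6 by linarith
    then show ?thesis by (simp add: n_def)
  qed
  finally show ?thesis .
qed

lemma threshold_bounds:
  assumes "0 \<le> a" "a \<le> b" "b \<le> pi" "0 \<le> D" "1 \<le> t" "D * ln t \<le> b - a"
  shows "(1 - cos a) / 2 \<le> threshold b D t" "threshold b D t \<le> (1 - cos b) / 2"
proof -
  have "0 \<le> D * ln t" using assms by (intro mult_nonneg_nonneg) auto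
  then have "cos (b - D * ln t) \<le> cos a" "cos b \<le> cos (b - D * ln t)"
    using assms by (intro cos_monotone_0_pi_le; linarith)+
  then show "(1 - cos a) / 2 \<le> threshold b D t" "threshold b D t \<le> (1 - cos b) / 2"
    by (auto simp: threshold_def)
qed

lemma threshold_antimono:
  assumes "0 \<le> D" "1 \<le> u" "u \<le> t" "D * ln t \<le> b" "b \<le> pi"
  shows "threshold b D t \<le> threshold b D u"
proof -
  have "0 \<le> D * ln u" "D * ln u \<le> D * ln t"
    using assms by (auto intro!: mult_nonneg_nonneg mult_left_mono)
  then have "cos (b - D * ln u) \<le> cos (b - D * ln t)"
    using assms by (intro cos_monotone_0_pi_le; linarith)
  then show ?thesis by (simp add: threshold_def)
qed

text \<open>Dropping happens only at \<open>t0\<close> or from \<open>t1\<close> on. Before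
  \<open>M\<close> the crude bound \<open>B\<close> is enough; from \<open>M\<close> on the decay
  rate \<open>c\<close> beats the weight \<open>\<theta>\<close>.\<close>

lemma sum_dead_prob_le:
  fixes \<theta> A B c q x :: real and s :: "nat \<Rightarrow> real" and M t0 t1 T :: nat
  defines "D \<equiv> race_rule x s t0 t1 T"
  assumes "0 \<le> \<theta>" "\<theta> \<le> c" and q: "0 \<le> q" "q \<le> 1"
    and first: "dead_prob D q t0 \<le> A"
    and early: "\<And>t. t1 \<le> t \<Longrightarrow> t \<le> T \<Longrightarrow> dead_prob D q t \<le> B"
    and late: "\<And>t. M \<le> t \<Longrightarrow> t \<le> T \<Longrightarrow> dead_prob D q t \<le> exp (2 - c * t)"
    and "t1 \<le> M" "t1 \<le> T"
  shows "(\<Sum>t=1..T. exp (\<theta> * t) * dead_prob D q t) \<le>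
    exp (\<theta> * t0) * A + M * (exp (\<theta> * M) * B) + T * exp (2 - (c - \<theta>) * t1)"
proof -
  have d0: "0 \<le> dead_prob D q t" for t by (rule dead_prob_nonneg[OF q])
  have A0: "0 \<le> A" using d0[of t0] first by linarith
  have B0: "0 \<le> B" using early[of t1] d0[of t1] \<open>t1 \<le> T\<close> by linarith
  have "exp (\<theta> * t) * dead_prob D q t \<le>
     (if t = t0 then exp (\<theta> * t0) * A else 0) + (if t < M then exp (\<theta> * M) * B else 0) +
     exp (2 - (c - \<theta>) * t1)" if "t \<in> {1..T}" for t
  proof -
    consider "t = t0" | "t \<noteq> t0" "t < t1" | "t \<noteq> t0" "t1 \<le> t" "t < M" | "t \<noteq> t0" "M \<le> t" by linarith
    then show ?thesis
    proof cases
      case 1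
      then have "exp (\<theta> * t) * dead_prob D q t \<le> exp (\<theta> * t0) * A"
        using first by simp
      then show ?thesis using 1 B0 by (auto intro!: add_nonneg_nonneg add_increasing2)
    next
      case 2
      then show ?thesis using dead_prob_eq_0[of t t0 t1] B0 by (auto simp: D_def)
    next
      case 3
      have "\<theta> * t \<le> \<theta> * M" using 3 \<open>0 \<le> \<theta>\<close> by (intro mult_left_mono) auto
      then have "exp (\<theta> * t) * dead_prob D q t \<le> exp (\<theta> * M) * B"
        using 3 that early d0 by (intro mult_mono) auto
      then show ?thesis using 3 by (auto intro!: add_increasing2)
    next
      case 4
      have "exp (\<theta> * t) * dead_prob D q t \<le> exp (\<theta> * t) * exp (2 - c * t)"
        using 4 late that by (intro mult_left_mono) auto
      also have "\<dots> = exp (2 - (c - \<theta>) * t)" by (simp add: exp_add[symmetric] algebra_simps)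
      also have "\<dots> \<le> exp (2 - (c - \<theta>) * t1)"
        using 4 \<open>\<theta> \<le> c\<close> \<open>t1 \<le> M\<close> by (simp add: mult_left_mono)
      finally show ?thesis using 4 B0 by auto
    qed
  qed
  then have "(\<Sum>t=1..T. exp (\<theta> * t) * dead_prob D q t) \<le>
     (\<Sum>t=1..T. (if t = t0 then exp (\<theta> * t0) * A else 0) + (if t < M then exp (\<theta> * M) * B else 0) +
     exp (2 - (c - \<theta>) * t1))"
    by (rule sum_mono)
  also have "\<dots> = (\<Sum>t=1..T. if t = t0 then exp (\<theta> * t0) * A else 0) +
     (\<Sum>t=1..T. if t < M then exp (\<theta> * M) * B else 0) + T * exp (2 - (c - \<theta>) * t1)"
    by (simp add: sum.distrib)
  also have "(\<Sum>t=1..T. if t = t0 then exp (\<theta> * t0) * A else 0) \<le> exp (\<theta> * t0) * A"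
    using A0 by (simp add: sum.delta)
  also have "(\<Sum>t=1..T. if t < M then exp (\<theta> * M) * B else 0) \<le> M * (exp (\<theta> * M) * B)"
  proof -
    have "(\<Sum>t=1..T. if t < M then exp (\<theta> * M) * B else 0) = (\<Sum>t\<in>{1..T} \<inter> {..<M}. exp (\<theta> * M) * B)"
      by (simp add: sum.If_cases lessThan_def)
    also have "\<dots> \<le> (\<Sum>t<M. exp (\<theta> * M) * B)" using B0 by (intro sum_mono2) auto
    finally show ?thesis by simp
  qed
  finally show ?thesis by simp
qed

subsection \<open>Asymptotics\<close>

text \<open>The exponents are chosen so that, with \<open>l = ln N\<close>, the first check is free (\<open>t0 \<ll> l\<^sup>2\<close>), it
  outweighs the times of order \<open>t1\<close> (\<open>t1 / l\<^sup>2 \<ll> t0\<close>), and later times survive a union bound over at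
  most \<open>N\<close> of them (\<open>l \<ll> t1 / l\<^sup>2\<close>).\<close>
definition angle_race :: "real \<Rightarrow> real \<Rightarrow> real \<Rightarrow> nat \<Rightarrow> bandit_alg" where
  "angle_race a b b' N = race_alg (race_rule ((1 - cos b') / 2) (threshold b ((b - a) / ln N))
     (nat \<lceil>ln N powr (3/2)\<rceil>) (nat \<lceil>ln N powr (13/4)\<rceil>) (nat \<lfloor>N / ln N\<rfloor>))"

text \<open>Means within \<open>d\<close> of the current threshold fall under the drift bound. Any
  other mean needs a deviation of fixed size, costing \<open>d\<^sup>2 / 2\<close> per reward, at
  least \<open>\<kappa> * D\<^sup>2\<close>. The constant \<open>v\<close> bounds the variance from
  below along the whole path of the threshold.\<close>

lemma dead_prob_late:
  fixes a b D \<kappa> v d q x :: real and K t t0 t1 T :: nat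
  defines "n \<equiv> Suc K"
  assumes ang: "0 < a" "a < b" "b < pi" and D: "0 < D" "D * ln T \<le> b - a"
    and q: "0 \<le> q" "q \<le> 1" and t: "t0 < t1" "0 < t1" "2 * n * t1 \<le> t" "t \<le> T"
    and v: "v = (1 - cos a) / 2 * (1 - (1 - cos b) / 2)"
    and d: "0 < d" "d \<le> 1" and \<kappa>: "0 \<le> \<kappa>" "\<kappa> \<le> 1" "\<kappa> * D\<^sup>2 \<le> d\<^sup>2 / 2"
    and Y: "D / sqrt v * n \<le> 1" "D\<^sup>2 * n \<le> 1"
      "n * ((1 + d / v) * (1 / 2 + D / sqrt v * n) + D / sqrt v * (ln (2 * n))\<^sup>2 / 4 + \<kappa>) \<le> n - 1 - ln n"
  shows "dead_prob (race_rule x (threshold b D) t0 t1 T) q t \<le> exp (2 - \<kappa> * D\<^sup>2 * t)"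
proof (cases "\<bar>q - threshold b D t\<bar> \<le> d")
  case True
  have t1: "t1 < t" "1 \<le> t"
  proof -
    have "2 * t1 \<le> 2 * n * t1" by (simp add: n_def)
    then show "t1 < t" "1 \<le> t" using t by linarith+
  qed
  have "D * ln t \<le> D * ln T"
    using D t t1 by (intro mult_left_mono) auto
  then have Dt: "D * ln t \<le> b - a" using D(2) by (rule order_trans)
  have Dt0: "0 \<le> D * ln t" using D t1 by (intro mult_nonneg_nonneg) auto
  have v0: "0 < v" using ang cos_monotone_0_pi[of 0 a] cos_monotone_0_pi[of b pi] by (simp add: v)
  have "sin (b - D * ln t) > 0" using Dt Dt0 ang by (intro sin_gt_zero; linarith)
  moreover have "v \<le> threshold b D t * (1 - threshold b D t)"
    unfolding v using threshold_bounds[of a b D t] ang D Dt t1 cos_le_one[of "b - D * ln t"]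
    by (intro mult_mono) (auto simp: threshold_def)
  ultimately show ?thesis
    using True v0 D q t \<kappa> Y unfolding n_def by (intro dead_prob_near[where v = v and d = d])
next
  case False
  have t1: "t1 < t" "1 \<le> t" "1 \<le> t - 1"
  proof -
    have "2 * t1 \<le> 2 * n * t1" by (simp add: n_def)
    then show "t1 < t" "1 \<le> t" "1 \<le> t - 1" using t by linarith+
  qed
  have "D * ln t \<le> D * ln T"
    using D t t1 by (intro mult_left_mono) auto
  then have "D * ln t \<le> b - a" using D(2) by (rule order_trans)
  then have "threshold b D t \<le> threshold b D (t - 1)"
    using D ang t1 by (intro threshold_antimono; linarith)
  then have "dead_prob (race_rule x (threshold b D) t0 t1 T) q t \<le> exp (- (real (t - 1) * d\<^sup>2 / 2))"
    using False d q t t1 by (intro dead_prob_far) auto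
  also have "\<dots> \<le> exp (2 - \<kappa> * D\<^sup>2 * t)"
  proof -
    have "\<kappa> * D\<^sup>2 * t \<le> d\<^sup>2 / 2 * t" using \<kappa> by (intro mult_right_mono) auto
    moreover have "d\<^sup>2 \<le> 1" using d by (simp add: power_le_one)
    moreover have "real (t - 1) * d\<^sup>2 / 2 = d\<^sup>2 / 2 * t - d\<^sup>2 / 2"
      using t1 by (simp add: of_nat_diff algebra_simps diff_divide_distrib)
    ultimately have "- (real (t - 1) * d\<^sup>2 / 2) \<le> 2 - \<kappa> * D\<^sup>2 * t" by linarith
    then show ?thesis by simp
  qed
  finally show ?thesis .
qed

lemma angle_race_fail_eventually:
  fixes a b b' x \<eta> c :: real
  assumes res: "reservoir \<mu>" and ang: "0 < a" "a < b" "b < b'" "b' < pi"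
    and good: "0 < \<eta>" "(1 - cos b') / 2 + \<eta> \<le> 1" "0 < measure \<mu> {(1 - cos b') / 2 + \<eta>..}"
    and x: "0 \<le> x" "x < (1 - cos a) / 2"
    and c: "0 < c" "c < (b - a)\<^sup>2 / 2"
  shows "\<forall>\<^sub>F N in sequentially. fail_prob (angle_race a b b' N) \<mu> N x \<le> exp (- c * N / (ln N)\<^sup>2)"
proof -
  define x0 where "x0 = (1 - cos b') / 2"
  define s0 where "s0 = (1 - cos b) / 2"
  define se where "se = (1 - cos a) / 2"
  define \<beta> where "\<beta> = measure \<mu> {x0 + \<eta>..}"
  define v where "v = se * (1 - s0)"
  define D0 where "D0 = b - a"
  define d where "d = (x0 - s0) / 2"
  have cosb: "cos b < cos a" "cos b' < cos b" "cos a < 1" "-1 < cos b"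
    using ang cos_monotone_0_pi[of a b] cos_monotone_0_pi[of b b'] cos_monotone_0_pi[of 0 a]
      cos_monotone_0_pi[of b pi] by auto
  have se: "0 < se" "se < s0" "s0 < 1" "s0 < x0" "x0 \<le> 1" "0 \<le> x0"
    using cosb by (auto simp: se_def s0_def x0_def)
  have v: "0 < v" using se by (auto simp: v_def)
  have d: "0 < d" "d \<le> 1" using se by (auto simp: d_def)
  have D0: "0 < D0" using ang by (simp add: D0_def)
  have "0 < \<beta>" using good by (simp add: \<beta>_def x0_def)
  have "\<eta> \<le> 1" using good cosb se by (simp add: x0_def[symmetric])
  \<comment> \<open>The gap of \<open>\<kappa>\<close> to 1/2 pays for the errors of the drift
    bound. Below, \<open>c' < \<kappa> * D0\<^sup>2\<close> controls late dropping times and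
    \<open>c < c'\<close> absorbs polynomial factors and the last \<open>T\<close> steps.\<close>
  obtain \<kappa> where \<kappa>: "c / D0\<^sup>2 < \<kappa>" "\<kappa> < 1 / 2"
    using dense[of "c / D0\<^sup>2" "1 / 2"] c D0 by (auto simp: D0_def field_simps)
  have "0 \<le> c / D0\<^sup>2" using c by simp
  then have \<kappa>0: "0 < \<kappa>" "c < \<kappa> * D0\<^sup>2"
    using \<kappa> D0 by (linarith, simp add: pos_divide_less_eq)
  obtain c' where c': "c < c'" "c' < \<kappa> * D0\<^sup>2" using dense \<kappa>0 by blast
  define \<zeta> where "\<zeta> = 1 / 2 - \<kappa>"
  define \<delta> where "\<delta> = min 1 (\<zeta> * v / 2)"
  have \<zeta>: "0 < \<zeta>" using \<kappa> by (simp add: \<zeta>_def)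
  have \<delta>: "0 < \<delta>" "\<delta> \<le> 1" "\<delta> / v \<le> \<zeta> / 2" using \<zeta> v by (auto simp: \<delta>_def min_def field_simps)
  \<comment> \<open>The number \<open>n\<close> of blocks is fixed before \<open>N\<close> grows;
    its error \<open>1 + ln n\<close> and the error from \<open>\<delta>\<close> each use at most a
    quarter of the room \<open>n * \<zeta>\<close>.\<close>
  have "(\<lambda>n::nat. (1 + ln n) / n) \<longlonglongrightarrow> 0" by real_asymp
  then have "\<forall>\<^sub>F n::nat in sequentially. (1 + ln n) / n < \<zeta> / 4 \<and> 0 < n"
    using \<zeta> by (intro eventually_conj order_tendstoD[where a = "\<zeta> / 4"] eventually_gt_at_top) auto
  then obtain n :: nat where n: "(1 + ln n) / n < \<zeta> / 4" "0 < n"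
    by (auto dest: eventually_happens)
  obtain K where K: "n = Suc K" using n by (cases n) auto
  define t0 where "t0 N = nat \<lceil>ln (real N) powr (3/2)\<rceil>" for N :: nat
  define t1 where "t1 N = nat \<lceil>ln (real N) powr (13/4)\<rceil>" for N :: nat
  define T where "T N = nat \<lfloor>N / ln (real N)\<rfloor>" for N :: nat
  define D where "D N = D0 / ln (real N)" for N :: nat
  define \<theta> where "\<theta> N = c' / (ln (real N))\<^sup>2" for N :: nat
  define r where "r N = race_rule x0 (threshold b (D N)) (t0 N) (t1 N) (T N)" for N
  define \<epsilon> where "\<epsilon> N = (2 * n * t1 N) * (exp (\<theta> N * (2 * n * t1 N)) * exp (- (t0 N * d\<^sup>2 / 2))) +
     T N * exp (2 - (\<kappa> * (D N)\<^sup>2 - \<theta> N) * t1 N)" for N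
  define G where "G N y = exp (\<theta> N * t0 N) * (if x0 + \<eta> \<le> y then exp (- (t0 N * \<eta>\<^sup>2 / 2)) else 1) + \<epsilon> N" for N and y :: real
  have ev_n: "\<forall>\<^sub>F N in sequentially. n * ((1 + \<delta> / v) * (1 / 2 + D N / sqrt v * n) + D N / sqrt v * (ln (2 * n))\<^sup>2 / 4 + \<kappa>) \<le> n - 1 - ln n"
  proof -
    have "(\<lambda>N. n * ((1 + \<delta> / v) * (1 / 2 + D N / sqrt v * n) + D N / sqrt v * (ln (2 * n))\<^sup>2 / 4 + \<kappa>))
       \<longlonglongrightarrow> n * ((1 + \<delta> / v) * (1 / 2 + 0 / sqrt v * n) + 0 / sqrt v * (ln (2 * n))\<^sup>2 / 4 + \<kappa>)"
    proof -
      have "D \<longlonglongrightarrow> 0" unfolding D_def using D0 by real_asymp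
      then show ?thesis using v by (intro tendsto_intros) auto
    qed
    moreover have "n * ((1 + \<delta> / v) * (1 / 2 + 0 / sqrt v * n) + 0 / sqrt v * (ln (2 * n))\<^sup>2 / 4 + \<kappa>) < n - 1 - ln n"
    proof -
      have "1 + ln n < n * (\<zeta> / 4)" using n by (simp add: field_simps)
      moreover have "n * ((1 + \<delta> / v) / 2 + \<kappa>) \<le> n * ((1 + \<zeta> / 2) / 2 + \<kappa>)"
        using \<delta> by (intro mult_left_mono) auto
      moreover have "n * ((1 + \<zeta> / 2) / 2 + \<kappa>) = n - n * (3 / 4 * \<zeta>)"
        by (simp add: \<zeta>_def field_simps)
      moreover have "0 < n * \<zeta>" using n \<zeta> by simp
      ultimately show ?thesis by simp
    qed
    ultimately show ?thesis
      by (rule eventually_mono[OF order_tendstoD(2)]) auto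
  qed
  have ev: "\<forall>\<^sub>F N in sequentially. 0 < D N" "\<forall>\<^sub>F N in sequentially. D N / sqrt v * n \<le> 1"
     "\<forall>\<^sub>F N in sequentially. (D N)\<^sup>2 * n \<le> 1" "\<forall>\<^sub>F N in sequentially. \<kappa> * (D N)\<^sup>2 \<le> \<delta>\<^sup>2 / 2"
    unfolding D_def using D0 v n \<kappa>0 \<delta> by real_asymp+
  have ev': "\<forall>\<^sub>F N in sequentially. 0 < t0 N" "\<forall>\<^sub>F N in sequentially. t0 N < t1 N"
     "\<forall>\<^sub>F N in sequentially. t1 N \<le> T N" "\<forall>\<^sub>F N in sequentially. T N \<le> N" "\<forall>\<^sub>F N in sequentially. 1 < ln (real N)"
  proof -
    have "\<forall>\<^sub>F N in sequentially. 0 < real (t0 N)" "\<forall>\<^sub>F N in sequentially. real (t0 N) < real (t1 N)"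
      "\<forall>\<^sub>F N in sequentially. real (t1 N) \<le> real (T N)" "\<forall>\<^sub>F N in sequentially. real (T N) \<le> real N"
      unfolding t0_def t1_def T_def by real_asymp+
    then show "\<forall>\<^sub>F N in sequentially. 0 < t0 N" "\<forall>\<^sub>F N in sequentially. t0 N < t1 N"
     "\<forall>\<^sub>F N in sequentially. t1 N \<le> T N" "\<forall>\<^sub>F N in sequentially. T N \<le> N"
      by simp_all
    show "\<forall>\<^sub>F N in sequentially. 1 < ln (real N)" by real_asymp
  qed
  \<comment> \<open>With \<open>l = ln N\<close>, the first part is a power of \<open>l\<close>
    times an exponential in which -l^(3/2) dominates l^(5/4); the second is N / l times an
    exponential of order -l^(5/4).\<close>
  have \<epsilon>: "\<epsilon> \<longlonglongrightarrow> 0"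
  proof -
    define \<psi> where "\<psi> = \<kappa> * D0\<^sup>2 - c'"
    have "0 < \<psi>" using c' by (simp add: \<psi>_def)
    have "(\<lambda>N. real (2 * n * t1 N) * (exp (\<theta> N * real (2 * n * t1 N)) * exp (- (t0 N * d\<^sup>2 / 2)))) \<longlonglongrightarrow> 0"
      unfolding \<theta>_def t1_def t0_def of_nat_mult using n d c' c by real_asymp
    moreover have "(\<lambda>N. T N * exp (2 - \<psi> / (ln (real N))\<^sup>2 * t1 N)) \<longlonglongrightarrow> 0"
      unfolding T_def t1_def using \<open>0 < \<psi>\<close> by real_asymp
    moreover have "\<kappa> * (D N)\<^sup>2 - \<theta> N = \<psi> / (ln (real N))\<^sup>2" for N
      by (simp add: \<psi>_def D_def \<theta>_def power_divide diff_divide_distrib)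
    ultimately show ?thesis
      unfolding \<epsilon>_def[abs_def] by (simp only: tendsto_add_zero)
  qed
  \<comment> \<open>Since \<open>\<theta> N * t0 N\<close> is of order l^(-1/2), the integral of
    \<open>G N\<close> tends to \<open>1 - \<beta>\<close>: arms above the first bar by the margin
    \<open>\<eta>\<close> are almost never dropped early, and their mass pays for all vanishing
    excesses.\<close>
  have int: "\<forall>\<^sub>F N in sequentially. (\<integral>\<^sup>+ y. ennreal (G N y) \<partial>\<mu>) \<le> 1"
  proof -
    have "prob_space \<mu>" and [measurable_cong]: "sets \<mu> = sets borel"
      using res by (auto simp: reservoir_def)
    then interpret prob_space \<mu> by simp
    have e: "(\<integral>\<^sup>+ y. ennreal (G N y) \<partial>\<mu>) =
        ennreal (exp (\<theta> N * t0 N) + \<epsilon> N - exp (\<theta> N * t0 N) * (1 - exp (- (t0 N * \<eta>\<^sup>2 / 2))) * \<beta>)"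
      if "0 \<le> \<epsilon> N" for N
    proof -
      have G: "G N y = exp (\<theta> N * t0 N) + \<epsilon> N -
          exp (\<theta> N * t0 N) * (1 - exp (- (t0 N * \<eta>\<^sup>2 / 2))) * indicator {x0 + \<eta>..} y" for y
        by (simp add: G_def indicator_def algebra_simps)
      have [simp]: "integrable \<mu> (indicat_real {x0 + \<eta>..})"
        by (intro integrable_real_indicator) (auto simp: emeasure_eq_measure)
      have "(\<integral>\<^sup>+ y. ennreal (G N y) \<partial>\<mu>) = ennreal (\<integral>y. G N y \<partial>\<mu>)"
      proof (rule nn_integral_eq_integral)
        show "integrable \<mu> (G N)" unfolding G[abs_def] by (intro Bochner_Integration.integrable_diff) auto
        show "AE y in \<mu>. 0 \<le> G N y" using that by (auto simp: G_def intro!: add_nonneg_nonneg)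
      qed
      also have "(\<integral>y. G N y \<partial>\<mu>) = exp (\<theta> N * t0 N) + \<epsilon> N - exp (\<theta> N * t0 N) * (1 - exp (- (t0 N * \<eta>\<^sup>2 / 2))) * \<beta>"
        unfolding G[abs_def] by (simp add: prob_space \<beta>_def)
      finally show ?thesis .
    qed
    have "(\<lambda>N. exp (\<theta> N * t0 N)) \<longlonglongrightarrow> 1"
      unfolding \<theta>_def t0_def using c c' by real_asymp
    moreover have "(\<lambda>N. exp (- (t0 N * \<eta>\<^sup>2 / 2))) \<longlonglongrightarrow> 0"
      unfolding t0_def using good by real_asymp
    ultimately have "(\<lambda>N. exp (\<theta> N * t0 N) + \<epsilon> N - exp (\<theta> N * t0 N) * (1 - exp (- (t0 N * \<eta>\<^sup>2 / 2))) * \<beta>) \<longlonglongrightarrow> 1 + 0 - 1 * (1 - 0) * \<beta>"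
      by (intro tendsto_intros \<epsilon>)
    then have "\<forall>\<^sub>F N in sequentially. exp (\<theta> N * t0 N) + \<epsilon> N - exp (\<theta> N * t0 N) * (1 - exp (- (t0 N * \<eta>\<^sup>2 / 2))) * \<beta> < 1"
      by (rule order_tendstoD) (use \<open>0 < \<beta>\<close> in simp)
    then show ?thesis
      by eventually_elim (subst e, auto simp: \<epsilon>_def ennreal_le_1)
  qed
  \<comment> \<open>Here \<open>T N\<close> is negligible against \<open>N\<close>, and the
    acceptance error has an exponent of order N / ln N, larger than N / (ln N)^2.\<close>
  have fin: "\<forall>\<^sub>F N in sequentially. real (N + 1) * exp (- \<theta> N * (real N - real (T N))) +
      real (N + 1) ^ 2 * exp (- (T N * (se - x)\<^sup>2 / 2)) \<le> exp (- c * N / (ln N)\<^sup>2)"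
  proof -
    define d1 where "d1 = se - x"
    have "0 < d1" using x by (simp add: d1_def se_def)
    have "(\<lambda>N. real (N + 1) ^ 2 * exp (- (T N * d1\<^sup>2 / 2)) * exp (c * real N / (ln N)\<^sup>2)) \<longlonglongrightarrow> 0"
      unfolding T_def using c \<open>0 < d1\<close> by real_asymp
    moreover have "(\<lambda>N. real (N + 1) * exp (- \<theta> N * (real N - real (T N))) * exp (c * real N / (ln N)\<^sup>2)) \<longlonglongrightarrow> 0"
      unfolding \<theta>_def T_def using c c' by real_asymp
    ultimately have "(\<lambda>N. (real (N + 1) * exp (- \<theta> N * (real N - real (T N))) +
      real (N + 1) ^ 2 * exp (- (T N * d1\<^sup>2 / 2))) * exp (c * real N / (ln N)\<^sup>2)) \<longlonglongrightarrow> 0"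
      unfolding distrib_right by (intro tendsto_add_zero)
    then have "\<forall>\<^sub>F N in sequentially. (real (N + 1) * exp (- \<theta> N * (real N - real (T N))) +
      real (N + 1) ^ 2 * exp (- (T N * d1\<^sup>2 / 2))) * exp (c * real N / (ln N)\<^sup>2) < 1"
      by (rule order_tendstoD) simp
    then show ?thesis
      by eventually_elim (simp add: d1_def exp_minus field_simps)
  qed
  show ?thesis
    using ev_n ev ev' int fin
  proof eventually_elim
    case (elim N)
    have T1: "1 \<le> T N" "1 \<le> t1 N" using elim by linarith+
    have "ln (T N) \<le> ln N" using elim T1 by simp
    then have "D N * ln (T N) \<le> D N * ln N" using elim by (intro mult_left_mono) auto
    also have "\<dots> = b - a" using elim by (simp add: D_def D0_def)
    finally have DT: "D N * ln (T N) \<le> b - a" .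
    have Dt: "D N * ln t \<le> b - a" if "1 \<le> t" "t \<le> T N" for t
    proof -
      have "D N * ln t \<le> D N * ln (T N)" using that elim by (intro mult_left_mono) auto
      then show ?thesis using DT by linarith
    qed
    have "0 \<le> \<theta> N" using c c' by (simp add: \<theta>_def)
    have "\<theta> N \<le> \<kappa> * (D N)\<^sup>2"
      using c' by (simp add: \<theta>_def D_def power_divide divide_right_mono)
    have "fail_prob (race_alg (r N)) \<mu> N x \<le>
        real (N + 1) * exp (- \<theta> N * (N - T N)) + real (N + 1) ^ 2 * exp (- (T N * (se - x)\<^sup>2 / 2))"
    proof (rule fail_prob_race_le[OF res])
      show "length w \<le> T N" if "r N w" for w
        using that elim by (auto simp: r_def race_rule_def)
      show "G N \<in> borel_measurable borel" unfolding G_def[abs_def] by measurable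
      show "(\<integral>\<^sup>+ y. ennreal (G N y) \<partial>\<mu>) \<le> 1" using elim by simp
      show "0 \<le> \<theta> N" by fact
      show "T N \<le> N" "0 < T N" "0 \<le> exp (- (T N * (se - x)\<^sup>2 / 2))" using elim T1 by auto
    next
      fix y :: real
      have "(\<Sum>t=1..T N. exp (\<theta> N * t) * dead_prob (r N) (bern_mean y) t) \<le>
        exp (\<theta> N * t0 N) * (if x0 + \<eta> \<le> y then exp (- (t0 N * \<eta>\<^sup>2 / 2)) else 1) +
        (2 * n * t1 N) * (exp (\<theta> N * (2 * n * t1 N)) * exp (- (t0 N * d\<^sup>2 / 2))) +
        T N * exp (2 - (\<kappa> * (D N)\<^sup>2 - \<theta> N) * t1 N)"
        unfolding r_def
      proof (rule sum_dead_prob_le)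
        show "dead_prob (race_rule x0 (threshold b (D N)) (t0 N) (t1 N) (T N)) (bern_mean y) (t0 N)
          \<le> (if x0 + \<eta> \<le> y then exp (- (t0 N * \<eta>\<^sup>2 / 2)) else 1)"
          using elim good \<open>\<eta> \<le> 1\<close> by (auto simp: x0_def intro!: dead_prob_first_check dead_prob_le_1)
      next
        fix t assume t: "t1 N \<le> t" "t \<le> T N"
        have "threshold b (D N) t \<le> s0"
          unfolding s0_def using t T1 ang elim Dt[of t] by (intro threshold_bounds[of a]) auto
        then have "threshold b (D N) t + 2 * d \<le> x0" by (simp add: d_def field_simps)
        then show "dead_prob (race_rule x0 (threshold b (D N)) (t0 N) (t1 N) (T N)) (bern_mean y) t
            \<le> exp (- (t0 N * d\<^sup>2 / 2))"
          using t elim d by (intro dead_prob_gap) auto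
      next
        fix t assume t: "2 * n * t1 N \<le> t" "t \<le> T N"
        show "dead_prob (race_rule x0 (threshold b (D N)) (t0 N) (t1 N) (T N)) (bern_mean y) t
            \<le> exp (2 - \<kappa> * (D N)\<^sup>2 * t)"
        proof (rule dead_prob_late[where a = a and v = v and d = \<delta> and K = K])
          show "v = (1 - cos a) / 2 * (1 - (1 - cos b) / 2)" by (simp add: v_def se_def s0_def)
        qed (use t T1 elim ang DT \<delta> \<kappa> \<kappa>0 in \<open>auto simp: K\<close>)
      qed (use \<open>0 \<le> \<theta> N\<close> \<open>\<theta> N \<le> \<kappa> * (D N)\<^sup>2\<close> elim n in auto)
      then show "(\<Sum>t=1..T N. exp (\<theta> N * t) * dead_prob (r N) (bern_mean y) t) \<le> G N y"
        by (simp add: G_def \<epsilon>_def)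
    next
      fix y assume "y < x"
      have "se \<le> threshold b (D N) (T N)"
        unfolding se_def using T1 ang elim DT by (intro threshold_bounds) auto
      show "(\<Sum>w\<in>{w\<in>words (T N). \<not> r N w}. bprob (bern_mean y) w) \<le> exp (- (T N * (se - x)\<^sup>2 / 2))"
      proof (rule bprob_tail_ge)
        fix w assume w: "w \<in> words (T N)" "\<not> r N w"
        \<comment> \<open>As \<open>x\<close> is nonnegative, the truncated mean is still at most
          \<open>x\<close>, so passing the last check is a deviation of
          \<open>se - x\<close>.\<close>
        have "T N * (bern_mean y + (se - x)) \<le> T N * threshold b (D N) (T N)"
          using \<open>y < x\<close> x \<open>se \<le> threshold b (D N) (T N)\<close> by (intro mult_left_mono) auto
        also have "\<dots> \<le> succs (take (T N) w)"
          using w elim by (auto simp: r_def race_rule_def words_def)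
        finally show "T N * (bern_mean y + (se - x)) \<le> succs (take (T N) w)" .
      qed (use x[folded se_def] se in \<open>auto, linarith?\<close>)
    qed
    also have "real (N - T N) = real N - real (T N)" using elim by (simp add: of_nat_diff)
    also note elim(12)
    finally show ?case
      unfolding angle_race_def r_def t0_def t1_def T_def D_def D0_def x0_def .
  qed
qed

section \<open>The essential supremum of a reservoir, and negative targets\<close>

lemma res_sup_props:
  assumes "reservoir \<mu>" "0 < res_sup \<mu>"
  shows "res_sup \<mu> \<le> 1" "\<And>z. z < res_sup \<mu> \<Longrightarrow> 0 < measure \<mu> {z..}"
proof -
  have "prob_space \<mu>" and [measurable_cong]: "sets \<mu> = sets borel" and one: "emeasure \<mu> {0..1} = 1"
    using assms(1) by (auto simp: reservoir_def)
  then interpret prob_space \<mu> by simp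
  have "AE y in \<mu>. y \<in> {0..1}"
    using one by (intro AE_prob_1) (simp add: measure_def)
  then have le: "esssup \<mu> (\<lambda>y. ereal y) \<le> 1"
    by (intro esssup_I) auto
  then show "res_sup \<mu> \<le> 1"
    unfolding res_sup_def by (cases "esssup \<mu> (\<lambda>y. ereal y)") auto
  \<comment> \<open>\<open>real_of_ereal\<close> sends infinite values to 0, so positivity of
    \<open>res_sup\<close> excludes them.\<close>
  have eq: "esssup \<mu> (\<lambda>y. ereal y) = ereal (res_sup \<mu>)"
    using assms(2) le unfolding res_sup_def by (cases "esssup \<mu> (\<lambda>y. ereal y)") auto
  fix z assume "z < res_sup \<mu>"
  then have "0 < emeasure \<mu> {y \<in> space \<mu>. ereal y > ereal z}"
    by (intro esssup_pos_measure) (auto simp: eq)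
  also have "\<dots> \<le> emeasure \<mu> {z..}" by (intro emeasure_mono) auto
  finally show "0 < measure \<mu> {z..}" by (simp add: emeasure_eq_measure)
qed

text \<open>Almost surely all means are nonnegative. This settles essential suprema below
  \<open>\<epsilon>\<^sub>1\<close>.\<close>

lemma fail_prob_neg:
  assumes "reservoir \<mu>" "x < 0"
  shows "fail_prob A \<mu> N x = 0"
proof -
  have "prob_space \<mu>" and [measurable_cong]: "sets \<mu> = sets borel" and one: "emeasure \<mu> {0..1} = 1"
    using assms(1) by (auto simp: reservoir_def)
  interpret prob_space \<mu> by fact
  interpret P: product_prob_space "\<lambda>_ :: nat. \<mu>" UNIV ..
  have "AE y in \<mu>. y \<in> {0..1}"
    using one by (intro AE_prob_1) (simp add: measure_def)
  then have "AE p in means_measure \<mu>. p i \<in> {0..1}" for i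
    unfolding means_measure_def by (intro P.AE_component) auto
  then have "AE p in means_measure \<mu>. \<forall>i. p i \<in> {0..1}"
    by (simp add: AE_all_countable)
  then have "AE p in means_measure \<mu>. ennreal (measure_pmf.prob (output_dist A p N) {i. p i < x}) = 0"
  proof eventually_elim
    case (elim p)
    then have "\<not> p i < x" for i using assms(2) order_trans[of 0 "p i" x] by force
    then show ?case by simp
  qed
  then have "(\<integral>\<^sup>+ p. ennreal (measure_pmf.prob (output_dist A p N) {i. p i < x}) \<partial>means_measure \<mu>) =
      (\<integral>\<^sup>+ p. 0 \<partial>means_measure \<mu>)"
    by (rule nn_integral_cong_AE)
  then show ?thesis
    unfolding fail_prob_def by simp
qed

section \<open>Rational angles and their coding\<close>

lemma cos_arccos_angle:
  assumes "0 \<le> y" "y \<le> 1"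
  shows "(1 - cos (arccos (1 - 2 * y))) / 2 = y"
  using assms by (subst cos_arccos) auto

lemma frequently_le_Limsup:
  fixes f :: "'a \<Rightarrow> 'b :: complete_lattice"
  assumes "\<exists>\<^sub>F x in F. l \<le> f x"
  shows "l \<le> Limsup F f"
  unfolding Limsup_def
proof (rule INF_greatest)
  fix P assume "P \<in> {P. eventually P F}"
  then obtain x where "P x" "l \<le> f x"
    using frequently_ex[OF frequently_eventually_frequently[OF assms]] by blast
  then show "l \<le> Sup (f ` Collect P)" by (intro SUP_upper2[of x]) auto
qed

text \<open>The second component of the pair is free, and the code of \<open>(j, M)\<close> is at
  least \<open>M\<close>.\<close>

lemma frequently_decode: "\<exists>\<^sub>F N in sequentially. fst (prod_decode N) = j"
  unfolding frequently_sequentially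
proof
  fix M
  have "M \<le> prod_encode (j, M)" by (rule le_prod_encode_2)
  then show "\<exists>N\<ge>M. fst (prod_decode N) = j"
    by (intro exI[of _ "prod_encode (j, M)"]) simp
qed

text \<open>Because \<open>\<epsilon> < \<epsilon>\<^sub>1\<close>, the angle \<open>a\<close> can
  lie strictly below that of \<open>m - \<epsilon>\<close>. The width gained lets \<open>b\<close>
  and \<open>b'\<close> stay strictly below the angle of \<open>m\<close> while \<open>b - a\<close>
  still exceeds the angle difference in \<open>c_const\<close>.\<close>

lemma exists_rat_angles:
  fixes m \<epsilon> \<epsilon>\<^sub>1 :: real
  assumes "0 < \<epsilon>" "\<epsilon> < \<epsilon>\<^sub>1" "\<epsilon>\<^sub>1 \<le> m" "m \<le> 1"
  obtains a b b' :: rat where "0 < a" "a < b" "b < b'" "of_rat b' < pi"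
    "m - \<epsilon>\<^sub>1 < (1 - cos (of_rat a)) / 2" "(1 - cos (of_rat b')) / 2 < m"
    "c_const m (m - \<epsilon>) < (of_rat b - of_rat a)\<^sup>2 / 2"
proof -
  define \<phi> where "\<phi> y = arccos (1 - 2 * y)" for y :: real
  have mono: "\<phi> y < \<phi> z" if "0 \<le> y" "y < z" "z \<le> 1" for y z
    unfolding \<phi>_def using that by (intro arccos_less_arccos) auto
  have lt: "y < (1 - cos p) / 2" if "\<phi> y < p" "p \<le> pi" "0 \<le> y" "y \<le> 1" for p y
  proof -
    have "cos p < cos (\<phi> y)"
      using that unfolding \<phi>_def by (intro cos_monotone_0_pi arccos_lbound) auto
    then show ?thesis using cos_arccos_angle[of y] that by (simp add: \<phi>_def)
  qed
  have gt: "(1 - cos p) / 2 < y" if "p < \<phi> y" "0 \<le> p" "0 \<le> y" "y \<le> 1" for p y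
  proof -
    have "cos (\<phi> y) < cos p"
      using that unfolding \<phi>_def by (intro cos_monotone_0_pi arccos_ubound) auto
    then show ?thesis using cos_arccos_angle[of y] that by (simp add: \<phi>_def)
  qed
  have p: "0 \<le> \<phi> (m - \<epsilon>\<^sub>1)" "\<phi> m \<le> pi"
    unfolding \<phi>_def using assms by (auto intro!: arccos_lbound arccos_ubound)
  have 1: "\<phi> (m - \<epsilon>\<^sub>1) < \<phi> (m - \<epsilon>)" "\<phi> (m - \<epsilon>) < \<phi> m"
    using assms by (auto intro!: mono)
  obtain a where a: "\<phi> (m - \<epsilon>\<^sub>1) < of_rat a" "of_rat a < \<phi> (m - \<epsilon>)"
    using of_rat_dense[OF 1(1)] by blast
  have "max (of_rat a) (\<phi> m - (\<phi> (m - \<epsilon>) - of_rat a)) < \<phi> m" using a 1 by auto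
  then obtain b where b: "max (of_rat a) (\<phi> m - (\<phi> (m - \<epsilon>) - of_rat a)) < of_rat b" "of_rat b < \<phi> m"
    using of_rat_dense by blast
  obtain b' where b': "of_rat b < (of_rat b' :: real)" "of_rat b' < \<phi> m"
    using of_rat_dense[OF b(2)] by blast
  have "(\<phi> m - \<phi> (m - \<epsilon>))\<^sup>2 < (of_rat b - of_rat a)\<^sup>2"
    using b 1 by (intro power_strict_mono) auto
  then have "c_const m (m - \<epsilon>) < (of_rat b - of_rat a)\<^sup>2 / 2"
    by (simp add: c_const_def \<phi>_def)
  moreover have "0 < (of_rat a :: real)" "of_rat b' < pi" using a b' p by linarith+
  moreover have "m - \<epsilon>\<^sub>1 < (1 - cos (of_rat a)) / 2"
    using a 1 p assms by (intro lt) auto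
  moreover have "(1 - cos (of_rat b')) / 2 < m"
  proof (rule gt[OF b'(2)])
    have "(of_rat a :: real) < of_rat b" using b by simp
    then show "0 \<le> (of_rat b' :: real)" using b' \<open>0 < (of_rat a :: real)\<close> by linarith
  qed (use assms in auto)
  ultimately show ?thesis
    using b b' by (intro that[of a b b']) (auto simp: of_rat_less zero_less_of_rat_iff)
qed

theorem theorem1p11:
  fixes \<epsilon> \<epsilon>\<^sub>1 :: real
  assumes "0 < \<epsilon>" and "\<epsilon> < \<epsilon>\<^sub>1" and "\<epsilon>\<^sub>1 < 1"
  shows "\<exists>A :: nat \<Rightarrow> bandit_alg. \<forall>\<mu>. reservoir \<mu> \<and> res_sup \<mu> > \<epsilon> \<longrightarrow>
           limsup (\<lambda>N. rate_term (fail_prob (A N) \<mu> N (res_sup \<mu> - \<epsilon>\<^sub>1)) N)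
             \<ge> ereal (c_const (res_sup \<mu>) (res_sup \<mu> - \<epsilon>))"
proof -
  \<comment> \<open>Every rational triple is \<open>par N\<close> for infinitely many
    \<open>N\<close>, so the algorithms need no knowledge of the reservoir.\<close>
  define par :: "nat \<Rightarrow> rat \<times> rat \<times> rat" where "par N = from_nat (fst (prod_decode N))" for N
  define A where "A N = (case par N of (a, b, b') \<Rightarrow> angle_race (of_rat a) (of_rat b) (of_rat b') N)" for N
  have "ereal (c_const (res_sup \<mu>) (res_sup \<mu> - \<epsilon>)) \<le>
      limsup (\<lambda>N. rate_term (fail_prob (A N) \<mu> N (res_sup \<mu> - \<epsilon>\<^sub>1)) N)"
    if res: "reservoir \<mu>" and sup: "\<epsilon> < res_sup \<mu>" for \<mu>
  proof -
    let ?m = "res_sup \<mu>"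
    let ?R = "\<lambda>N. rate_term (fail_prob (A N) \<mu> N (?m - \<epsilon>\<^sub>1)) N"
    have m: "?m \<le> 1" "0 < ?m" and pos: "\<And>z. z < ?m \<Longrightarrow> 0 < measure \<mu> {z..}"
      using res_sup_props[OF res] sup assms by auto
    have "\<exists>\<^sub>F N in sequentially. ereal (c_const ?m (?m - \<epsilon>)) \<le> ?R N"
    \<comment> \<open>For a negative target the failure probability is 0 and
      \<open>rate_term\<close> is \<open>\<infinity>\<close>.\<close>
    proof (cases "?m < \<epsilon>\<^sub>1")
      case True
      have "fail_prob (A N) \<mu> N (?m - \<epsilon>\<^sub>1) = 0" for N
        using True by (intro fail_prob_neg res) simp
      then show ?thesis by (simp add: rate_term_def)
    next
      case False
      obtain a b b' :: rat where ang: "0 < a" "a < b" "b < b'" "of_rat b' < pi"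
        and x: "?m - \<epsilon>\<^sub>1 < (1 - cos (of_rat a)) / 2" "(1 - cos (of_rat b')) / 2 < ?m"
        and c: "c_const ?m (?m - \<epsilon>) < (of_rat b - of_rat a)\<^sup>2 / 2"
        using exists_rat_angles[of \<epsilon> \<epsilon>\<^sub>1 ?m] assms False m by auto
      have ang': "0 < (of_rat a :: real)" "of_rat a < (of_rat b :: real)" "of_rat b < (of_rat b' :: real)"
        using ang by (simp_all add: of_rat_less)
      have "0 \<le> c_const ?m (?m - \<epsilon>)" by (simp add: c_const_def)
      \<comment> \<open>With \<open>c\<close> strictly above the claimed constant, infinitely many
        \<open>N\<close> satisfy the bound outright and no further limit in the angles is
        taken.\<close>
      obtain c where c': "c_const ?m (?m - \<epsilon>) < c" "c < (of_rat b - of_rat a)\<^sup>2 / 2"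
        using dense[OF c] by blast
      \<comment> \<open>Arms with mean at least \<open>z\<close> clear the first bar by a fixed
        margin and have positive mass.\<close>
      obtain z where z: "(1 - cos (of_rat b')) / 2 < z" "z < ?m" using dense x by blast
      have "\<forall>\<^sub>F N in sequentially.
        fail_prob (angle_race (of_rat a) (of_rat b) (of_rat b') N) \<mu> N (?m - \<epsilon>\<^sub>1) \<le> exp (- c * N / (ln N)\<^sup>2)"
        using res ang ang' x z pos[OF z(2)] c' m False \<open>0 \<le> c_const ?m (?m - \<epsilon>)\<close>
        by (intro angle_race_fail_eventually[where \<eta> = "z - (1 - cos (of_rat b')) / 2"]) auto
      moreover have "\<exists>\<^sub>F N in sequentially. par N = (a, b, b')"
        using frequently_decode[of "to_nat (a, b, b')"]
        by (rule frequently_elim1) (simp add: par_def)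
      ultimately have "\<exists>\<^sub>F N in sequentially. par N = (a, b, b') \<and>
        fail_prob (angle_race (of_rat a) (of_rat b) (of_rat b') N) \<mu> N (?m - \<epsilon>\<^sub>1) \<le> exp (- c * N / (ln N)\<^sup>2) \<and> 2 \<le> N"
        by (intro frequently_eventually_frequently eventually_conj eventually_ge_at_top)
      then show ?thesis
      proof (rule frequently_elim1)
        fix N :: nat
        define P where "P = fail_prob (A N) \<mu> N (?m - \<epsilon>\<^sub>1)"
        assume N: "par N = (a, b, b') \<and>
          fail_prob (angle_race (of_rat a) (of_rat b) (of_rat b') N) \<mu> N (?m - \<epsilon>\<^sub>1) \<le> exp (- c * N / (ln N)\<^sup>2) \<and> 2 \<le> N"
        then have P: "P \<le> exp (- c * N / (ln N)\<^sup>2)" by (simp add: P_def A_def)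
        show "ereal (c_const ?m (?m - \<epsilon>)) \<le> ?R N"
        proof (cases "P = 0")
          case True
          then show ?thesis by (simp add: rate_term_def P_def)
        next
          case False
          have "0 \<le> P" by (simp add: P_def fail_prob_def)
          with False have "0 < P" by simp
          then have "ln P \<le> - c * N / (ln N)\<^sup>2"
            using P by (metis ln_exp ln_le_cancel_iff exp_gt_zero)
          then have "c * N / (ln N)\<^sup>2 \<le> - ln P" by simp
          moreover have "0 < ln (real N)" using N by simp
          ultimately have "c \<le> - ln P * (ln N)\<^sup>2 / N"
            using N by (simp add: field_simps)
          then show ?thesis using False c' by (simp add: rate_term_def P_def)
        qed
      qed
    qed
    then show ?thesis by (rule frequently_le_Limsup)
  qed
  then show ?thesis by (intro exI[of _ A]) auto
qed

end
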